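(* For the round-robin induced periodic system (RRIPS) $$\bar x_{k+1}=\bar A\,\bar x_k+\bar B(z)w_k,\qquad y_k^{m_k}=\bar H_{m_k}\bar x_k+v_k^{m_k},$$ described in the context, and under the standing assumptions on the risk-sensitive filter listed there, the predicted mean and the predicted error covariance can be obtained as $$\hat{\bar x}_{k|k-1}=\bar A\,\hat{\bar x}_{k-1|k-1},\qquad \bar P_{k|k-1}=\bar A\left(\bar P_{k-1|k-1}^{-1}-2\mu_{1,k-1}I\right)^{-1}\bar A^{\top}+\bar Q_k ,$$ where $\hat{\bar x}_{k-1|k-1}$ is the posterior estimate and $\bar P_{k-1|k-1}$ is the posterior error covariance at time $k-1$.
   Context: System. The nominal discrete-time stochastic singular system is $Ex_{k+1}=Ax_k+Bw_k$, $y_k=Hx_k+v_k$, with $E,A\in\mathbb{R}^{n\times n}$, $\operatorname{rank}E<n$, $B\in\mathbb{R}^{n\times r}$, $H\in\mathbb{R}^{q\times n}$, and $(E,A)$ regular, i.e. $\det(\lambda E-A)\not\equiv0$. The noises $w_k,v_k$ are zero-mean Gaussian with $\mathbb E[w_kw_k^\top]=Q_k$, $\mathbb E[v_kv_k^\top]=R_k$, and $\mathbb E[w_kv_j^\top]=0$ for all $k,j$. The initial state $x_0$ is zero-mean with known covariance, independent of $v_k$, but possibly correlated with $w_0$ and finitely many future process noise terms. By regularity there are nonsingular $U,V$ (Weierstrass canonical form) with $UEV=\operatorname{diag}(I_{n_1},N)$, $UAV=\operatorname{diag}(A_1,I_{n_2})$, $n_1+n_2=n$, $N$ nilpotent with $N^h=0$.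 Write $UB=[B_1^\top\ B_2^\top]^\top$, $HV=[H_1\ H_2]$, $x_k=V\bar x_k$. Set $\bar A=\operatorname{diag}(A_1,0)$, $\bar H=[H_1\ H_2]$, $\bar B(z)=B^{(0)}+B^{(1)}z+\dots+B^{(h)}z^h$, where $z$ is the forward shift ($zw_k=w_{k+1}$), $B^{(0)}=\begin{bmatrix}B_1\\0\end{bmatrix}$, $B^{(i)}=-\begin{bmatrix}0\\N^{i-1}B_2\end{bmatrix}$ for $i=1,\dots,h$. The process noise covariance of the transformed model is $\bar Q_k=\mathbb E[(\bar B(z)w_k)(\bar B(z)w_k)^\top]=\sum_{i=0}^hB^{(i)}Q_{k+i}(B^{(i)})^\top$. Round-robin protocol. Only $q'$ of the $q$ measurement components are transmitted at each time. With $\sigma=\lceil q/q'\rceil$ and $m_k=(k\bmod\sigma)+1$, $y_k^{m_k}$ consists of components $(m_k-1)q'+1,\dots,m_kq'$ of $y_k$ (if $m_k=\sigma$: components $(\sigma-1)q'+1,\dots,q$, with additional entries from the first $(\sigma-1)q'$ components appended if needed so that the length is $q'$); $v_k^{m_k}$ and $\bar H_{m_k}$ consist of the corresponding entries of $v_k$ and rows of $\bar H$. The received measurements up to time $k$ are denoted $y_{1:k}^{m_k}$. Risk-sensitive estimation. Let $\mu_{1,i}\ge0$ and $\mu_{2,k}>0$ be risk parameters, and $e_{i|i}=\bar x_i-\hat{\bar x}_{i|i}$ the posterior estimation error. The posterior estimate $\hat{\bar x}_{k|k}$ is the minimizer of the cost $\mathbb E\big[\exp\big(\sum_{i=1}^{k-1}\mu_{1,i}e_{i|i}^\top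 e_{i|i}+\mu_{2,k}e_{k|k}^\top e_{k|k}\big)\big]$ given $y_{1:k}^{m_k}$ (the earlier optimal estimates being already available). The information state is $\Phi_k=p(\bar x_k\mid\mathcal I_k)=\exp\big(\sum_{i=0}^{k-1}\mu_{1,i}e_{i|i}^\top e_{i|i}\big)\,p(\bar x_k\mid y_{1:k}^{m_k})$ with $\Phi_0=p(\bar x_0)$ and $\mathcal I_k=\{y_{1:k}^{m_k},e_{1|1},\dots,e_{k-1|k-1}\}$. The predicted information state, with $\bar{\mathcal I}_{k-1}=\{\mathcal I_{k-1},e_{k-1|k-1}\}$, is $$p(\bar x_k\mid\bar{\mathcal I}_{k-1})=\int p(\bar x_k\mid\bar x_{k-1})\exp\!\left(\mu_{1,k-1}e_{k-1|k-1}^\top e_{k-1|k-1}\right)\Phi_{k-1}\,d\bar x_{k-1},$$ and the information state is propagated by $\Phi_k=p(y_k^{m_k}\mid\bar x_k)\,p(\bar x_k\mid\bar{\mathcal I}_{k-1})/p(y_k^{m_k}\mid y_{1:k-1}^{m_k})$. Standing assumptions on the filter: $\Phi_k$ is assumed to be an unnormalized Gaussian density for sufficiently small nonnegative $\mu_{1,k-1}$ ($\Phi_0=p(\bar x_0)$ being Gaussian), and $\mu_{1,k-1}$ is selected such that $2\mu_{1,k-1}\bar P_{k-1|k-1}<I$ (in the positive definite order). Meaning of the remaining terms: $\bar P_{k|k}$, the posterior error covariance, is the covariance of the Gaussian $\Phi_k$; the predicted mean $\hat{\bar x}_{k|k-1}$ and predicted error covariance $\bar P_{k|k-1}$ are the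 mean and covariance associated with the predicted information state $p(\bar x_k\mid\bar{\mathcal I}_{k-1})$.
   Formalization: The covariance term is Q̄_{k-1} (displayed Q̄_k is off by one if Q_k varies); p(x̄_k|x̄_{k-1}) takes B̄(z)w_{k-1} independent of x̄_{k-1}; the cost's error sum starts at i=0, as in Φ_k; w_k is assumed uncorrelated in time, as the formula for Q̄_k needs. *)

theory Defs
  imports "HOL-Probability.Probability"
begin

section \<open>Matrices and Gaussian laws\<close>

text \<open>
  Matrix power with respect to the matrix product (the overloaded power of the type of vectors
  is componentwise).
\<close>

primrec mpow :: "real^'n^'n \<Rightarrow> nat \<Rightarrow> real^'n^'n" where
  "mpow X 0 = mat 1"
| "mpow X (Suc i) = X ** mpow X i"

definition pos_def :: "real^'n^'n \<Rightarrow> bool" where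
  "pos_def X \<longleftrightarrow> transpose X = X \<and> (\<forall>x. x \<noteq> 0 \<longrightarrow> 0 < x \<bullet> (X *v x))"

text \<open>
  The splitting \<open>n = n\<^sub>1 + n\<^sub>2\<close> is encoded by the set \<open>S\<close> of the \<open>n\<^sub>1\<close> coordinates that form the
  first block, the second block being the complement of \<open>S\<close>; in this way \<open>n\<^sub>1 = 0\<close> is allowed.
  Blocks are stored in matrices of full size, whose other entries are ignored:
  \<open>block_diag S X Y\<close> is \<open>diag(X, Y)\<close>, and \<open>block_rows S X\<close> is \<open>X\<close> with all rows outside \<open>S\<close> replaced
  by zero.
\<close>

definition block_diag :: "'n set \<Rightarrow> real^'n^'n \<Rightarrow> real^'n^'n \<Rightarrow> real^'n^'n" where
  "block_diag S X Y =
     (\<chi> i j. if i \<in> S \<and> j \<in> S then X $ i $ j else if i \<notin> S \<and> j \<notin> S then Y $ i $ j else 0)"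

definition block_rows :: "'n set \<Rightarrow> real^'m^'n \<Rightarrow> real^'m^'n" where
  "block_rows S X = (\<chi> i j. if i \<in> S then X $ i $ j else 0)"

definition gauss_density :: "real^'n \<Rightarrow> real^'n^'n \<Rightarrow> real^'n \<Rightarrow> real" where
  "gauss_density m P x =
     exp (- ((x - m) \<bullet> (matrix_inv P *v (x - m))) / 2) / sqrt ((2 * pi) ^ CARD('n) * det P)"

definition unnormalized_gaussian :: "(real^'n) measure \<Rightarrow> real^'n \<Rightarrow> real^'n^'n \<Rightarrow> bool" where
  "unnormalized_gaussian \<nu> m P \<longleftrightarrow>
     pos_def P \<and> (\<exists>c>0. \<nu> = density lborel (\<lambda>x. ennreal (c * gauss_density m P x)))"

text \<open>Gaussian random vectors, possibly with a singular covariance matrix.\<close>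

definition gaussian_vector :: "'a measure \<Rightarrow> ('a \<Rightarrow> real^'n) \<Rightarrow> bool" where
  "gaussian_vector M X \<longleftrightarrow> X \<in> borel_measurable M \<and>
     (\<forall>a. (\<exists>m. AE \<omega> in M. a \<bullet> X \<omega> = m) \<or>
          (\<exists>m s. 0 < s \<and> distributed M lborel (\<lambda>\<omega>. a \<bullet> X \<omega>) (\<lambda>t. ennreal (normal_density m s t))))"

definition zero_mean :: "'a measure \<Rightarrow> ('a \<Rightarrow> real^'n) \<Rightarrow> bool" where
  "zero_mean M X \<longleftrightarrow> integrable M X \<and> integral\<^sup>L M X = 0"

text \<open>The matrix \<open>E[X Y\<^sup>T]\<close>.\<close>

definition cross_moment :: "'a measure \<Rightarrow> ('a \<Rightarrow> real^'n) \<Rightarrow> ('a \<Rightarrow> real^'m) \<Rightarrow> real^'m^'n" where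
  "cross_moment M X Y = (\<chi> i j. integral\<^sup>L M (\<lambda>\<omega>. X \<omega> $ i * Y \<omega> $ j))"

definition independent :: "'a measure \<Rightarrow> ('a \<Rightarrow> 'b::topological_space) \<Rightarrow> ('a \<Rightarrow> 'c::topological_space) \<Rightarrow> bool" where
  "independent M X Y \<longleftrightarrow>
     prob_space.indep_set M {X -` C \<inter> space M | C. C \<in> sets borel} {Y -` D \<inter> space M | D. D \<in> sets borel}"

text \<open>Mean and covariance of an unnormalized law.\<close>

definition has_mean_cov :: "(real^'n) measure \<Rightarrow> real^'n \<Rightarrow> real^'n^'n \<Rightarrow> bool" where
  "has_mean_cov \<nu> m P \<longleftrightarrow>
     sets \<nu> = sets borel \<and> finite_measure \<nu> \<and> 0 < measure \<nu> UNIV \<and>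
     integrable \<nu> (\<lambda>x. (norm x)\<^sup>2) \<and>
     m = (1 / measure \<nu> UNIV) *\<^sub>R (\<integral>x. x \<partial>\<nu>) \<and>
     P = (1 / measure \<nu> UNIV) *\<^sub>R (\<chi> i j. \<integral>x. (x - m) $ i * (x - m) $ j \<partial>\<nu>)"


section \<open>Singular systems and their transformed model\<close>

definition regular_pencil :: "real^'n^'n \<Rightarrow> real^'n^'n \<Rightarrow> bool" where
  "regular_pencil E A \<longleftrightarrow> \<not> (\<forall>l. det (l *\<^sub>R E - A) = 0)"

definition weierstrass_form ::
  "real^'n^'n \<Rightarrow> real^'n^'n \<Rightarrow> real^'n^'n \<Rightarrow> real^'n^'n \<Rightarrow> 'n set \<Rightarrow> real^'n^'n \<Rightarrow> real^'n^'n \<Rightarrow> nat \<Rightarrow> bool"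
where
  "weierstrass_form E A U V S A1 N h \<longleftrightarrow>
     invertible U \<and> invertible V \<and>
     U ** E ** V = block_diag S (mat 1) N \<and>
     U ** A ** V = block_diag S A1 (mat 1) \<and>
     mpow (block_diag S 0 N) h = 0"

text \<open>
  The coefficients of \<open>z ^ i\<close> in the noise polynomial; \<open>UB\<close> stands for the product \<open>U ** B\<close>.
  Note that multiplying \<open>block_rows (- S) UB\<close> by the zeroth power of \<open>block_diag S 0 N\<close> leaves it
  unchanged.
\<close>

definition noise_coeff :: "'n set \<Rightarrow> real^'n^'n \<Rightarrow> real^'r^'n \<Rightarrow> nat \<Rightarrow> real^'r^'n" where
  "noise_coeff S N UB i =
     (if i = 0 then block_rows S UB
      else - (mpow (block_diag S 0 N) (i - 1) ** block_rows (- S) UB))"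

definition shifted_noise :: "(nat \<Rightarrow> real^'r^'n) \<Rightarrow> nat \<Rightarrow> (nat \<Rightarrow> 'a \<Rightarrow> real^'r) \<Rightarrow> nat \<Rightarrow> 'a \<Rightarrow> real^'n" where
  "shifted_noise Bc h w k \<omega> = (\<Sum>i\<le>h. Bc i *v w (k + i) \<omega>)"

definition shifted_noise_cov :: "(nat \<Rightarrow> real^'r^'n) \<Rightarrow> nat \<Rightarrow> (nat \<Rightarrow> real^'r^'r) \<Rightarrow> nat \<Rightarrow> real^'n^'n" where
  "shifted_noise_cov Bc h Q k = (\<Sum>i\<le>h. Bc i ** Q (k + i) ** transpose (Bc i))"

lemma block_diag_mult_vector:
  "(block_diag S X Y *v u) = (\<chi> i. if i \<in> S then (X *v (\<chi> j. if j \<in> S then u $ j else 0)) $ i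
      else (Y *v (\<chi> j. if j \<in> S then 0 else u $ j)) $ i)"
  by (auto simp: vec_eq_iff block_diag_def matrix_vector_mult_def intro!: sum.cong)

lemma block_rows_mult_vector: "block_rows S X *v u = (\<chi> i. if i \<in> S then (X *v u) $ i else 0)"
  by (auto simp: vec_eq_iff block_rows_def matrix_vector_mult_def)

lemma matrix_vector_mult_uminus_left: "(- (X::real^'n^'m)) *v u = - (X *v u)"
  by (simp add: vec_eq_iff matrix_vector_mult_def sum_negf)

lemma mpow_comm: "mpow X i ** X = X ** mpow X i"
  by (induction i) (simp_all add: matrix_mul_assoc[symmetric])

text \<open>
  Every solution of the singular system, in the transformed coordinates, solves the recursion whose
  transition law is used by the filter.
\<close>

lemma singular_system_transformed:
  fixes E A U V A1 N :: "real^'n^'n" and B :: "real^'r^'n" and x :: "nat \<Rightarrow> real^'n"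
  assumes wf: "weierstrass_form E A U V S A1 N h"
    and sys: "\<And>j. E *v x (Suc j) = A *v x j + B *v w j \<omega>"
  shows "matrix_inv V *v x (Suc k) =
    block_diag S A1 0 *v (matrix_inv V *v x k) + shifted_noise (noise_coeff S N (U ** B)) h w k \<omega>"
proof -
  define X where "X j = matrix_inv V *v x j" for j
  define Nt where "Nt = block_diag S 0 N"
  define s where "s j = (\<chi> i. if i \<in> S then 0 else X j $ i)" for j
  define b where "b j = block_rows (- S) (U ** B) *v w j \<omega>" for j
  have V: "V ** matrix_inv V = mat 1"
    using wf someI_ex[of "\<lambda>W. V ** W = mat 1 \<and> W ** V = mat 1"]
    unfolding weierstrass_form_def invertible_def matrix_inv_def by blast
  have x: "x j = V *v X j" for j
    by (simp add: X_def matrix_vector_mul_assoc V)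
  have eq: "block_diag S (mat 1) N *v X (Suc j) = block_diag S A1 (mat 1) *v X j + (U ** B) *v w j \<omega>" for j
    using arg_cong[OF sys[of j], of "\<lambda>u. U *v u"] wf
    unfolding weierstrass_form_def
    by (metis x matrix_vector_mul_assoc matrix_vector_right_distrib)
  have st: "s j = Nt *v s (Suc j) - b j" for j
    using eq[of j]
    by (auto simp: vec_eq_iff Nt_def s_def b_def block_diag_mult_vector block_rows_mult_vector cong: if_cong)
      (smt (verit))+
  have it: "s k = mpow Nt m *v s (k + m) - (\<Sum>i<m. mpow Nt i *v b (k + i))" for k m
  proof (induction m)
    case (Suc m)
    have "mpow Nt m *v s (k + m) = mpow Nt (Suc m) *v s (k + Suc m) - mpow Nt m *v b (k + m)"
      by (subst st) (simp add: matrix_vector_mult_diff_distrib matrix_vector_mul_assoc mpow_comm)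
    with Suc show ?case by simp
  qed simp
  have "mpow Nt h = 0" using wf by (simp add: weierstrass_form_def Nt_def)
  then have s: "s (Suc k) = - (\<Sum>i<h. mpow Nt i *v b (Suc k + i))"
    using it[of "Suc k" h] by simp
  have "shifted_noise (noise_coeff S N (U ** B)) h w k \<omega>
      = block_rows S (U ** B) *v w k \<omega> + (\<Sum>i\<in>{1..h}. noise_coeff S N (U ** B) i *v w (k + i) \<omega>)"
    unfolding shifted_noise_def
    by (subst sum.atLeast1_atMost_eq[symmetric] | simp add: atMost_atLeast0 sum.atLeast_Suc_atMost noise_coeff_def)+
  also have "(\<Sum>i\<in>{1..h}. noise_coeff S N (U ** B) i *v w (k + i) \<omega>)
      = (\<Sum>i<h. - (mpow Nt i *v b (Suc k + i)))"
    unfolding b_def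
    by (rule sum.reindex_bij_witness[of _ Suc "\<lambda>i. i - 1"])
      (auto simp: noise_coeff_def Nt_def matrix_vector_mul_assoc matrix_vector_mult_uminus_left)
  also have "\<dots> = s (Suc k)" using s by (simp add: sum_negf)
  finally have sh: "shifted_noise (noise_coeff S N (U ** B)) h w k \<omega>
      = block_rows S (U ** B) *v w k \<omega> + s (Suc k)" .
  have "X (Suc k) = block_diag S A1 0 *v X k + (block_rows S (U ** B) *v w k \<omega> + s (Suc k))"
    using eq[of k]
    by (auto simp: vec_eq_iff s_def block_diag_mult_vector block_rows_mult_vector split: if_splits)
  then show ?thesis by (simp add: sh X_def)
qed


section \<open>Round-robin protocol\<close>

text \<open>
  \<open>cq\<close> numbers the components of the measurement by \<open>1, \<dots>, q\<close> and \<open>cs\<close> numbers the slots of the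
  transmitted vector by \<open>1, \<dots>, q'\<close>. In round \<open>m\<close>, slot \<open>j\<close> carries the component \<open>sel m j\<close>. The
  protocol does not determine which components fill up the last round.
\<close>

definition rr_period :: "nat \<Rightarrow> nat \<Rightarrow> nat" where
  "rr_period q q' = nat \<lceil>real q / real q'\<rceil>"

definition rr_round :: "nat \<Rightarrow> nat \<Rightarrow> nat" where
  "rr_round \<sigma> k = k mod \<sigma> + 1"

definition round_robin :: "('q \<Rightarrow> nat) \<Rightarrow> ('s \<Rightarrow> nat) \<Rightarrow> (nat \<Rightarrow> 's \<Rightarrow> 'q) \<Rightarrow> bool" where
  "round_robin cq cs sel \<longleftrightarrow>
     bij_betw cq UNIV {1..CARD('q)} \<and> bij_betw cs UNIV {1..CARD('s)} \<and>
     (\<forall>m\<in>{1..rr_period CARD('q) CARD('s)}. \<forall>j.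
        if (m - 1) * CARD('s) + cs j \<le> CARD('q)
        then cq (sel m j) = (m - 1) * CARD('s) + cs j
        else cq (sel m j) \<in> {1..(rr_period CARD('q) CARD('s) - 1) * CARD('s)})"

definition select :: "('s \<Rightarrow> 'q) \<Rightarrow> 'b^'q \<Rightarrow> 'b^'s" where
  "select f y = (\<chi> j. y $ f j)"

definition select_cov :: "('s \<Rightarrow> 'q) \<Rightarrow> real^'q^'q \<Rightarrow> real^'s^'s" where
  "select_cov f R = (\<chi> i j. R $ f i $ f j)"


section \<open>Risk-sensitive filter\<close>

text \<open>
  The transition law \<open>p(x\<^sub>k\<^sub>+\<^sub>1 | x\<^sub>k = \<xi>)\<close> of \<open>x\<^sub>k\<^sub>+\<^sub>1 = F x\<^sub>k + \<eta>\<^sub>k\<close>, with the disturbance \<open>\<eta>\<^sub>k\<close> taken to be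
  independent of the present state, as the filter does. It is a measure, since the covariance of
  \<open>\<eta>\<^sub>k\<close> may be singular.
\<close>

definition transition :: "'a measure \<Rightarrow> real^'n^'n \<Rightarrow> (nat \<Rightarrow> 'a \<Rightarrow> real^'n) \<Rightarrow> nat \<Rightarrow> real^'n \<Rightarrow> (real^'n) measure" where
  "transition M F \<eta> k \<xi> = distr M borel (\<lambda>\<omega>. F *v \<xi> + \<eta> k \<omega>)"

text \<open>
  If the disturbance is indeed independent of the present state, this is the conditional law in the usual
  sense.
\<close>

lemma (in prob_space) transition_conditional_law:
  fixes F :: "real^'n^'n"
  assumes ind: "indep_var borel X borel (\<eta> k)"
  shows "distr M (borel \<Otimes>\<^sub>M borel) (\<lambda>\<omega>. (X \<omega>, F *v X \<omega> + \<eta> k \<omega>)) =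
    distr M borel X \<bind> (\<lambda>\<xi>. distr (transition M F \<eta> k \<xi>) (borel \<Otimes>\<^sub>M borel) (Pair \<xi>))"
proof -
  have [measurable]: "random_variable borel X" "random_variable borel (\<eta> k)"
    using ind by (auto dest: indep_var_rv1 indep_var_rv2)
  interpret X: prob_space "distr M borel X" by (rule prob_space_distr) measurable
  interpret \<eta>: prob_space "distr M borel (\<eta> k)" by (rule prob_space_distr) measurable
  have [measurable]: "(\<lambda>\<xi>. F *v \<xi>) \<in> borel_measurable borel"
    by (intro borel_measurable_continuous_onI continuous_intros)
  have m: "(\<lambda>\<xi>. distr (distr M borel (\<eta> k)) (borel \<Otimes>\<^sub>M borel) (\<lambda>u. (\<xi>, F *v \<xi> + u)))
    \<in> borel \<rightarrow>\<^sub>M subprob_algebra (borel \<Otimes>\<^sub>M borel)"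
    by (rule measurable_distr2[where M="borel"]) (auto intro!: measurable_const simp: space_subprob_algebra \<eta>.subprob_space_axioms)
  have t: "distr (transition M F \<eta> k \<xi>) (borel \<Otimes>\<^sub>M borel) (Pair \<xi>)
     = distr (distr M borel (\<eta> k)) (borel \<Otimes>\<^sub>M borel) (\<lambda>u. (\<xi>, F *v \<xi> + u))" for \<xi>
    unfolding transition_def by (subst (1 2) distr_distr) (auto simp: comp_def)
  have "distr M (borel \<Otimes>\<^sub>M borel) (\<lambda>\<omega>. (X \<omega>, F *v X \<omega> + \<eta> k \<omega>))
     = distr (distr M (borel \<Otimes>\<^sub>M borel) (\<lambda>\<omega>. (X \<omega>, \<eta> k \<omega>))) (borel \<Otimes>\<^sub>M borel) (\<lambda>(\<xi>, u). (\<xi>, F *v \<xi> + u))"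
    by (subst distr_distr) (auto simp: comp_def)
  also have "distr M (borel \<Otimes>\<^sub>M borel) (\<lambda>\<omega>. (X \<omega>, \<eta> k \<omega>)) = distr M borel X \<Otimes>\<^sub>M distr M borel (\<eta> k)"
    using ind by (simp add: indep_var_distribution_eq)
  also have "distr \<dots> (borel \<Otimes>\<^sub>M borel) (\<lambda>(\<xi>, u). (\<xi>, F *v \<xi> + u))
     = distr M borel X \<bind> (\<lambda>\<xi>. distr (distr M borel (\<eta> k)) (borel \<Otimes>\<^sub>M borel) (\<lambda>u. (\<xi>, F *v \<xi> + u)))"
    (is "?l = ?r")
  proof (rule measure_eqI)
    show "sets ?l = sets ?r" by (subst sets_bind[where N="borel \<Otimes>\<^sub>M borel"]) auto
    fix C assume "C \<in> sets ?l"
    then have [measurable]: "C \<in> sets (borel \<Otimes>\<^sub>M borel)" by simp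
    have [measurable]: "(\<lambda>(\<xi>, u). (\<xi>, F *v \<xi> + u)) -` C \<in> sets (borel \<Otimes>\<^sub>M borel)"
      using measurable_sets[of "\<lambda>(\<xi>, u). (\<xi>, F *v \<xi> + u)" "borel \<Otimes>\<^sub>M borel" "borel \<Otimes>\<^sub>M borel" C]
      by (simp add: space_pair_measure)
    have "emeasure (distr M borel X \<Otimes>\<^sub>M distr M borel (\<eta> k)) ((\<lambda>(\<xi>, u). (\<xi>, F *v \<xi> + u)) -` C)
      = (\<integral>\<^sup>+ x. emeasure (distr M borel (\<eta> k)) (Pair x -` (\<lambda>(\<xi>, u). (\<xi>, F *v \<xi> + u)) -` C) \<partial>distr M borel X)"
      by (rule \<eta>.emeasure_pair_measure_alt) measurable
    also have "\<dots> = (\<integral>\<^sup>+ x. emeasure (distr M borel (\<eta> k)) ((\<lambda>u. (x, F *v x + u)) -` C) \<partial>distr M borel X)"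
      by (intro nn_integral_cong arg_cong2[where f=emeasure]) auto
    finally show "emeasure ?l C = emeasure ?r C"
      by (subst emeasure_bind[where N="borel \<Otimes>\<^sub>M borel"])
        (use m in \<open>auto simp: emeasure_distr space_pair_measure\<close>)
  qed
  finally show ?thesis by (simp add: t)
qed

text \<open>
  In the remaining definitions, \<open>p0\<close> is the law of the initial state, \<open>K k \<xi>\<close> is the law of the
  state at time \<open>k + 1\<close> given the state \<open>\<xi>\<close> at time \<open>k\<close>, and \<open>L k x\<close> is the density of the
  measurement received at time \<open>k\<close>, given the state \<open>x\<close> and evaluated at the received value. Thus the
  measurement record is fixed and enters through \<open>L\<close>.

  \<open>path_integral p0 K L k g\<close> is the integral of \<open>g (x\<^sub>0, \<dots>, x\<^sub>k)\<close> against
  \<open>p(x\<^sub>0, \<dots>, x\<^sub>k, y\<^sub>1, \<dots>, y\<^sub>k) = p(x\<^sub>0) p(x\<^sub>1 | x\<^sub>0) p(y\<^sub>1 | x\<^sub>1) \<dots> p(x\<^sub>k | x\<^sub>k\<^sub>-\<^sub>1) p(y\<^sub>k | x\<^sub>k)\<close>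
  over the states. Entries of the path beyond \<open>k\<close> are irrelevant.
\<close>

primrec path_integral ::
  "'x measure \<Rightarrow> (nat \<Rightarrow> 'x \<Rightarrow> 'x measure) \<Rightarrow> (nat \<Rightarrow> 'x \<Rightarrow> real) \<Rightarrow> nat \<Rightarrow> ((nat \<Rightarrow> 'x) \<Rightarrow> ennreal) \<Rightarrow> ennreal"
where
  "path_integral p0 K L 0 g = (\<integral>\<^sup>+ x. g (\<lambda>_. x) \<partial>p0)"
| "path_integral p0 K L (Suc k) g =
     path_integral p0 K L k
       (\<lambda>x. \<integral>\<^sup>+ z. g (x(Suc k := z)) * ennreal (L (Suc k) z) \<partial>K k (x k))"

text \<open>\<open>p(y\<^sub>1, \<dots>, y\<^sub>k)\<close>, and conditional expectation given \<open>y\<^sub>1, \<dots>, y\<^sub>k\<close>.\<close>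

definition evidence ::
  "'x measure \<Rightarrow> (nat \<Rightarrow> 'x \<Rightarrow> 'x measure) \<Rightarrow> (nat \<Rightarrow> 'x \<Rightarrow> real) \<Rightarrow> nat \<Rightarrow> ennreal" where
  "evidence p0 K L k = path_integral p0 K L k (\<lambda>_. 1)"

definition cond_expectation ::
  "'x measure \<Rightarrow> (nat \<Rightarrow> 'x \<Rightarrow> 'x measure) \<Rightarrow> (nat \<Rightarrow> 'x \<Rightarrow> real) \<Rightarrow> nat \<Rightarrow> ((nat \<Rightarrow> 'x) \<Rightarrow> ennreal) \<Rightarrow> ennreal"
where
  "cond_expectation p0 K L k g = path_integral p0 K L k g / evidence p0 K L k"

text \<open>
  The sum of the past errors starts at \<open>0\<close>, in accordance with the information state, which contains
  the error at time \<open>0\<close> from time \<open>1\<close> on.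
\<close>

definition risk_cost ::
  "(real^'n) measure \<Rightarrow> (nat \<Rightarrow> real^'n \<Rightarrow> (real^'n) measure) \<Rightarrow> (nat \<Rightarrow> real^'n \<Rightarrow> real)
    \<Rightarrow> (nat \<Rightarrow> real) \<Rightarrow> (nat \<Rightarrow> real) \<Rightarrow> (nat \<Rightarrow> real^'n) \<Rightarrow> nat \<Rightarrow> real^'n \<Rightarrow> ennreal"
where
  "risk_cost p0 K L \<mu>1 \<mu>2 xh k \<zeta> =
     cond_expectation p0 K L k
       (\<lambda>x. ennreal (exp ((\<Sum>i<k. \<mu>1 i * ((x i - xh i) \<bullet> (x i - xh i)))
                           + \<mu>2 k * ((x k - \<zeta>) \<bullet> (x k - \<zeta>)))))"

definition risk_sensitive_estimate ::
  "(real^'n) measure \<Rightarrow> (nat \<Rightarrow> real^'n \<Rightarrow> (real^'n) measure) \<Rightarrow> (nat \<Rightarrow> real^'n \<Rightarrow> real)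
    \<Rightarrow> (nat \<Rightarrow> real) \<Rightarrow> (nat \<Rightarrow> real) \<Rightarrow> (nat \<Rightarrow> real^'n) \<Rightarrow> nat \<Rightarrow> bool"
where
  "risk_sensitive_estimate p0 K L \<mu>1 \<mu>2 xh k \<longleftrightarrow>
     risk_cost p0 K L \<mu>1 \<mu>2 xh k (xh k) < \<infinity> \<and>
     (\<forall>\<zeta>. risk_cost p0 K L \<mu>1 \<mu>2 xh k (xh k) \<le> risk_cost p0 K L \<mu>1 \<mu>2 xh k \<zeta>)"

text \<open>The prediction step, from the information state at time \<open>k\<close> to time \<open>k + 1\<close>.\<close>

definition predict ::
  "(nat \<Rightarrow> real^'n \<Rightarrow> (real^'n) measure) \<Rightarrow> (nat \<Rightarrow> real) \<Rightarrow> (nat \<Rightarrow> real^'n) \<Rightarrow> nat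
    \<Rightarrow> (real^'n) measure \<Rightarrow> (real^'n) measure"
where
  "predict K \<mu>1 xh k \<Phi> =
     Giry_Monad.bind
       (density \<Phi> (\<lambda>\<xi>. ennreal (exp (\<mu>1 k * ((\<xi> - xh k) \<bullet> (\<xi> - xh k)))))) (K k)"

primrec information_state ::
  "(real^'n) measure \<Rightarrow> (nat \<Rightarrow> real^'n \<Rightarrow> (real^'n) measure) \<Rightarrow> (nat \<Rightarrow> real^'n \<Rightarrow> real)
    \<Rightarrow> (nat \<Rightarrow> real) \<Rightarrow> (nat \<Rightarrow> real^'n) \<Rightarrow> nat \<Rightarrow> (real^'n) measure"
where
  "information_state p0 K L \<mu>1 xh 0 = p0"
| "information_state p0 K L \<mu>1 xh (Suc k) =
     density (predict K \<mu>1 xh k (information_state p0 K L \<mu>1 xh k))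
       (\<lambda>x. ennreal (L (Suc k) x) / (evidence p0 K L (Suc k) / evidence p0 K L k))"

text \<open>Only meaningful for \<open>k \<ge> 1\<close>.\<close>

definition predicted_information_state ::
  "(real^'n) measure \<Rightarrow> (nat \<Rightarrow> real^'n \<Rightarrow> (real^'n) measure) \<Rightarrow> (nat \<Rightarrow> real^'n \<Rightarrow> real)
    \<Rightarrow> (nat \<Rightarrow> real) \<Rightarrow> (nat \<Rightarrow> real^'n) \<Rightarrow> nat \<Rightarrow> (real^'n) measure"
where
  "predicted_information_state p0 K L \<mu>1 xh k =
     predict K \<mu>1 xh (k - 1) (information_state p0 K L \<mu>1 xh (k - 1))"

text \<open>
  The recursion yields \<open>\<Phi>\<^sub>k = exp (\<Sum>i<k. \<mu>\<^sub>1\<^sub>i |x\<^sub>i - xh\<^sub>i|\<^sup>2) p(x\<^sub>k | y\<^sub>1, \<dots>, y\<^sub>k)\<close>, where the exponential has to be read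
  under the conditional expectation, as it depends on the earlier states.
\<close>

lemma nn_integral_information_state:
  fixes K :: "nat \<Rightarrow> real^'n \<Rightarrow> (real^'n) measure"
  assumes p0: "sets p0 = sets borel"
    and K: "\<And>j. K j \<in> borel \<rightarrow>\<^sub>M subprob_algebra borel"
    and L: "\<And>j. L j \<in> borel_measurable borel"
    and pos: "\<And>j. j \<le> k \<Longrightarrow> evidence p0 K L j \<noteq> 0" and fin: "\<And>j. j \<le> k \<Longrightarrow> evidence p0 K L j \<noteq> \<infinity>"
    and e0: "evidence p0 K L 0 = 1"
    and f: "f \<in> borel_measurable borel"
  shows "(\<integral>\<^sup>+ z. f z \<partial>information_state p0 K L \<mu>1 xh k)
   = cond_expectation p0 K L k
       (\<lambda>x. ennreal (exp (\<Sum>i<k. \<mu>1 i * ((x i - xh i) \<bullet> (x i - xh i)))) * f (x k))"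
  using pos fin f
proof (induction k arbitrary: f)
  case 0
  then show ?case using e0 by (simp add: cond_expectation_def divide_ennreal_def)
next
  case (Suc k)
  define Phi where "Phi = information_state p0 K L \<mu>1 xh k"
  define r where "r = evidence p0 K L (Suc k) / evidence p0 K L k"
  define e where "e \<xi> = ennreal (exp (\<mu>1 k * ((\<xi> - xh k) \<bullet> (\<xi> - xh k))))" for \<xi>
  define F where "F \<xi> = (\<integral>\<^sup>+ z. f z * ennreal (L (Suc k) z) \<partial>K k \<xi>)" for \<xi>
  note [measurable] = K L Suc.prems(3)
  have sets_info: "sets (information_state p0 K L \<mu>1 xh j) = sets borel" for j
  proof (induction j)
    case (Suc j)
    have "space (information_state p0 K L \<mu>1 xh j) \<noteq> {}"
      using sets_eq_imp_space_eq[OF Suc] by simp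
    moreover have "sets (K j x) = sets borel" for x
      by (rule subprob_measurableD(2)[OF K]) simp
    ultimately show ?case by (simp add: predict_def sets_bind)
  qed (simp add: p0)
  have [measurable_cong]: "sets Phi = sets borel" by (simp add: Phi_def sets_info)
  have sK: "sets (K k x) = sets borel" for x
    by (rule subprob_measurableD(2)[OF K]) simp
  have [measurable_cong]: "sets (predict K \<mu>1 xh k Phi) = sets borel"
    using sets_info[of "Suc k"] by (simp add: Phi_def)
  have [measurable]: "F \<in> borel_measurable borel"
    unfolding F_def by (rule nn_integral_measurable_subprob_algebra2[where N=borel]) measurable
  have [measurable]: "e \<in> borel_measurable borel" unfolding e_def by measurable
  have "(\<integral>\<^sup>+ z. f z \<partial>information_state p0 K L \<mu>1 xh (Suc k))
      = (\<integral>\<^sup>+ z. ennreal (L (Suc k) z) / r * f z \<partial>predict K \<mu>1 xh k Phi)"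
    unfolding information_state.simps Phi_def[symmetric] r_def[symmetric]
    by (rule nn_integral_density) measurable
  also have "\<dots> = (\<integral>\<^sup>+ z. (1 / r) * (f z * ennreal (L (Suc k) z)) \<partial>predict K \<mu>1 xh k Phi)"
    by (intro nn_integral_cong) (simp add: divide_ennreal_def mult_ac)
  also have "\<dots> = (1 / r) * (\<integral>\<^sup>+ z. f z * ennreal (L (Suc k) z) \<partial>predict K \<mu>1 xh k Phi)"
    by (rule nn_integral_cmult) measurable
  also have "(\<integral>\<^sup>+ z. f z * ennreal (L (Suc k) z) \<partial>predict K \<mu>1 xh k Phi)
      = (\<integral>\<^sup>+ \<xi>. F \<xi> \<partial>density Phi e)"
    unfolding predict_def F_def e_def
    by (rule nn_integral_bind[where B=borel]) measurable
  also have "\<dots> = (\<integral>\<^sup>+ \<xi>. e \<xi> * F \<xi> \<partial>Phi)"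
    by (rule nn_integral_density) measurable
  also have "\<dots> = path_integral p0 K L k
      (\<lambda>x. ennreal (exp (\<Sum>i<k. \<mu>1 i * ((x i - xh i) \<bullet> (x i - xh i)))) * (e (x k) * F (x k)))
        / evidence p0 K L k"
    unfolding Phi_def cond_expectation_def[symmetric] by (rule Suc.IH) (use Suc.prems in auto)
  also have "(\<lambda>x. ennreal (exp (\<Sum>i<k. \<mu>1 i * ((x i - xh i) \<bullet> (x i - xh i)))) * (e (x k) * F (x k)))
     = (\<lambda>x. \<integral>\<^sup>+ z. ennreal (exp (\<Sum>i<Suc k. \<mu>1 i * (((x(Suc k := z)) i - xh i) \<bullet> ((x(Suc k := z)) i - xh i))))
           * f ((x(Suc k := z)) (Suc k)) * ennreal (L (Suc k) z) \<partial>K k (x k))"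
    (is "?l = ?r")
  proof
    fix x
    have "?r x = (\<integral>\<^sup>+ z. (ennreal (exp (\<Sum>i<k. \<mu>1 i * ((x i - xh i) \<bullet> (x i - xh i)))) * e (x k))
        * (f z * ennreal (L (Suc k) z)) \<partial>K k (x k))"
      by (intro nn_integral_cong) (simp add: e_def exp_add ennreal_mult mult_ac)
    also have "\<dots> = ?l x"
      unfolding F_def by (subst nn_integral_cmult) (use sK in \<open>auto simp: mult_ac cong: measurable_cong_sets\<close>)
    finally show "?l x = ?r x" by simp
  qed
  finally have eq: "(\<integral>\<^sup>+ z. f z \<partial>information_state p0 K L \<mu>1 xh (Suc k)) =
    1 / r * (path_integral p0 K L (Suc k)
      (\<lambda>x. ennreal (exp (\<Sum>i<Suc k. \<mu>1 i * ((x i - xh i) \<bullet> (x i - xh i)))) * f (x (Suc k))) / evidence p0 K L k)"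
    (is "_ = 1 / r * (?J / _)") by simp
  have ne: "evidence p0 K L k \<noteq> 0" "evidence p0 K L k \<noteq> \<infinity>"
      "evidence p0 K L (Suc k) \<noteq> 0" "evidence p0 K L (Suc k) \<noteq> \<infinity>" using Suc.prems by auto
  have "1 / (b / a) * (J / a) = J / b" if "a \<noteq> 0" "a \<noteq> \<infinity>" "b \<noteq> 0" "b \<noteq> \<infinity>" for a b J :: ennreal
  proof -
    have "1 / (b / a) = a / b"
    proof -
      have "inverse (b * inverse a) = inverse b * inverse (inverse a)"
        by (rule ennreal_inverse_mult') (use that in \<open>auto simp: zero_less_iff_neq_zero ennreal_inverse_positive\<close>)
      moreover have "inverse (inverse a) = a"
        using that by (cases a rule: ennreal_cases) (auto simp: inverse_ennreal order_less_le)
      ultimately show ?thesis by (simp add: divide_ennreal_def mult.commute)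
    qed
    then have "1 / (b / a) * (J / a) = (a * inverse a) * (J / b)"
      by (simp add: divide_ennreal_def mult_ac)
    also have "a * inverse a = 1"
      using that ennreal_divide_self[of a] by (simp add: divide_ennreal_def top.not_eq_extremum)
    finally show ?thesis by simp
  qed
  from this[OF ne] show ?case unfolding eq r_def cond_expectation_def by blast
qed


end

theory Submission
  imports Defs "HOL-Real_Asymp.Real_Asymp"
begin

text \<open>
  The risk cost of a candidate \<open>\<zeta>\<close> is the integral of \<open>exp (\<mu>\<^sub>2 |x - \<zeta>|\<^sup>2)\<close> against the information
  state, a multiple of a Gaussian; by symmetry and the parallelogram law its only minimizer is the
  mean, so the estimate is the mean of the information state. Hence weighting the information state
  by \<open>exp (\<mu>\<^sub>1 |x - \<zeta>|\<^sup>2)\<close>, with \<open>\<zeta>\<close> the estimate, leaves the mean alone and subtracts \<open>2 \<mu>\<^sub>1 I\<close> from the inverse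
  covariance. The transition adds an independent centred disturbance to the image under the state
  matrix, and for this step only first and second moments matter.
\<close>

section \<open>Positive definite matrices\<close>

text \<open>The predicted law may have no density: \<open>Abar\<close> vanishes outside
  \<open>S\<close> and the noise covariance may be singular. Densities are therefore used only up to
  the weighting step. From there on, laws are described by the scalar integrals of
  \<open>a \<bullet> (x - m)\<close> and of its square for every direction \<open>a\<close>, which
  determine mean and covariance (the latter by polarization) and pass through a product measure.
  Three gaps shape the rest. The risk cost integrates over whole state paths and divides by the
  evidence, whereas the minimization concerns a law of the last state alone; joining the two
  requires every evidence to be finite and nonzero, which is extracted from the Gaussian assumption.
  The bound on \<open>\<mu>1\<close> restricts the covariance, whereas the weighting acts on its
  inverse; Cauchy-Schwarz for the quadratic form converts one into the other without eigenvalues.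
  Finally, normalizing constants are never evaluated: they are absorbed into the free factor of an
  unnormalized Gaussian, for which positivity of the determinant is enough.\<close>

lemma matrix_inv_mult:
  fixes X :: "real^'n^'n"
  assumes "invertible X"
  shows "X ** matrix_inv X = mat 1" "matrix_inv X ** X = mat 1"
  using assms someI_ex[of "\<lambda>W. X ** W = mat 1 \<and> W ** X = mat 1"]
  unfolding invertible_def matrix_inv_def by blast+

lemma matrix_inv_eqI:
  fixes X :: "real^'n^'n"
  assumes "X ** Y = mat 1"
  shows "matrix_inv X = Y"
proof -
  have "invertible X"
    using assms by (auto simp: invertible_right_inverse)
  then have "matrix_inv X = matrix_inv X ** (X ** Y)" "matrix_inv X ** X = mat 1"
    using assms matrix_inv_mult by auto
  then show ?thesis by (simp add: matrix_mul_assoc)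
qed

lemma inner_matrix_symmetric:
  fixes X :: "real^'n^'n"
  assumes "transpose X = X"
  shows "x \<bullet> (X *v y) = (X *v x) \<bullet> y"
  by (metis assms dot_lmul_matrix vector_transpose_matrix)

lemma pos_def_imp_invertible:
  fixes X :: "real^'n^'n"
  assumes "pos_def X"
  shows "invertible X"
proof -
  have "x = 0" if "X *v x = 0" for x
    using assms that unfolding pos_def_def by fastforce
  then show ?thesis
    using invertible_left_inverse matrix_left_invertible_ker by blast
qed

lemma pos_def_inner_nonneg: "pos_def X \<Longrightarrow> 0 \<le> x \<bullet> (X *v x)"
  unfolding pos_def_def by (cases "x = 0") (auto intro: less_imp_le)

text \<open>The segment from \<open>mat 1\<close> to \<open>X\<close> stays among positive definite,
  hence invertible, matrices, so the determinant cannot change sign on its way from 1. This makes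
  the normalizing constant in \<open>gauss_density\<close> positive.\<close>

lemma pos_def_imp_det_pos:
  fixes X :: "real^'n^'n"
  assumes "pos_def X"
  shows "0 < det X"
proof (rule ccontr)
  assume "\<not> 0 < det X"
  define g where "g t = det ((1 - t) *\<^sub>R mat 1 + t *\<^sub>R X)" for t :: real
  have "continuous_on {0..1} g"
    unfolding g_def det_def by (intro continuous_intros)
  moreover have "g 1 \<le> 0" "0 \<le> g 0"
    using \<open>\<not> 0 < det X\<close> by (auto simp: g_def)
  ultimately obtain t where t: "0 \<le> t" "t \<le> 1" "g t = 0"
    using IVT2'[of g 1 0 0] by auto
  have "pos_def ((1 - t) *\<^sub>R mat 1 + t *\<^sub>R X)"
    unfolding pos_def_def
  proof (intro conjI allI impI)
    show "transpose ((1 - t) *\<^sub>R mat 1 + t *\<^sub>R X) = (1 - t) *\<^sub>R mat 1 + t *\<^sub>R X"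
      using assms by (auto simp: pos_def_def transpose_def vec_eq_iff mat_def)
    fix x :: "real^'n" assume "x \<noteq> 0"
    then have "0 < x \<bullet> x" "0 < x \<bullet> (X *v x)"
      using assms by (auto simp: pos_def_def)
    moreover have "x \<bullet> (((1 - t) *\<^sub>R mat 1 + t *\<^sub>R X) *v x) = (1 - t) * (x \<bullet> x) + t * (x \<bullet> (X *v x))"
      by (simp add: matrix_vector_mult_add_rdistrib inner_add_right flip: scaleR_matrix_vector_assoc)
    ultimately show "0 < x \<bullet> (((1 - t) *\<^sub>R mat 1 + t *\<^sub>R X) *v x)"
      using t by (cases "t = 0") (auto intro: add_nonneg_pos)
  qed
  then show False
    using t(3) pos_def_imp_invertible invertible_det_nz by (auto simp: g_def)
qed

lemma pos_def_matrix_inv: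
  fixes X :: "real^'n^'n"
  assumes "pos_def X"
  shows "pos_def (matrix_inv X)"
proof -
  note inv = matrix_inv_mult[OF pos_def_imp_invertible[OF assms]]
  have sym: "transpose X = X" using assms by (simp add: pos_def_def)
  have "transpose (matrix_inv X) = matrix_inv X"
  proof (rule matrix_inv_eqI[symmetric])
    show "X ** transpose (matrix_inv X) = mat 1"
      using arg_cong[OF inv(2), of transpose] by (simp add: matrix_transpose_mul sym transpose_mat)
  qed
  moreover have "0 < x \<bullet> (matrix_inv X *v x)" if "x \<noteq> 0" for x
  proof -
    define y where "y = matrix_inv X *v x"
    have x: "x = X *v y" by (simp add: y_def matrix_vector_mul_assoc inv)
    then have "y \<noteq> 0" using that by auto
    then have "0 < y \<bullet> (X *v y)" using assms by (simp add: pos_def_def)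
    then show ?thesis by (simp add: y_def[symmetric] x[symmetric] inner_commute)
  qed
  ultimately show ?thesis by (simp add: pos_def_def)
qed

lemma pos_def_Cauchy_Schwarz:
  fixes X :: "real^'n^'n"
  assumes "pos_def X"
  shows "(x \<bullet> (X *v y))\<^sup>2 \<le> (x \<bullet> (X *v x)) * (y \<bullet> (X *v y))"
proof (cases "y = 0")
  case False
  define q where "q = y \<bullet> (X *v y)"
  define p where "p = x \<bullet> (X *v y)"
  have q: "0 < q" using assms False by (simp add: pos_def_def q_def)
  have sym: "y \<bullet> (X *v x) = p"
    using assms inner_matrix_symmetric[of X y x] by (simp add: pos_def_def p_def inner_commute)
  \<comment> \<open>The vector is \<open>q\<close> times the residual of \<open>x\<close> after
    projection onto \<open>y\<close> in the inner product of \<open>X\<close>; scaling by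
    \<open>q\<close> avoids division.\<close>
  have "0 \<le> (q *\<^sub>R x - p *\<^sub>R y) \<bullet> (X *v (q *\<^sub>R x - p *\<^sub>R y))"
    by (rule pos_def_inner_nonneg[OF assms])
  also have "\<dots> = q * (q * (x \<bullet> (X *v x)) - p\<^sup>2)"
    using sym by (simp add: matrix_vector_mult_diff_distrib inner_diff_left inner_diff_right
        matrix_vector_mult_scaleR power2_eq_square algebra_simps flip: p_def q_def)
  finally show ?thesis
    using q by (simp add: p_def q_def zero_le_mult_iff mult.commute)
qed simp

text \<open>Inversion reverses the order. With \<open>y = matrix_inv X *v x\<close>, Cauchy-Schwarz
  bounds the square of \<open>x \<bullet> x = x \<bullet> (X *v y)\<close> by
  \<open>x \<bullet> (X *v x)\<close> times \<open>x \<bullet> y\<close>, and the hypothesis bounds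
  \<open>c\<close> times the first factor by \<open>x \<bullet> x\<close>.\<close>

lemma pos_def_matrix_inv_minus_scaled_mat:
  fixes X :: "real^'n^'n"
  assumes X: "pos_def X" and less: "pos_def (mat 1 - c *\<^sub>R X)" and c: "0 \<le> c"
  shows "pos_def (matrix_inv X - c *\<^sub>R mat 1)"
proof -
  note inv = matrix_inv_mult[OF pos_def_imp_invertible[OF X]]
  have "transpose (matrix_inv X) = matrix_inv X"
    using pos_def_matrix_inv[OF X] by (simp add: pos_def_def)
  then have "transpose (matrix_inv X - c *\<^sub>R mat 1) = matrix_inv X - c *\<^sub>R mat 1"
    by (auto simp: transpose_def vec_eq_iff mat_def)
  moreover have "0 < x \<bullet> ((matrix_inv X - c *\<^sub>R mat 1) *v x)" if "x \<noteq> 0" for x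
  proof -
    define y where "y = matrix_inv X *v x"
    have x: "X *v y = x" by (simp add: y_def matrix_vector_mul_assoc inv)
    have "y \<noteq> 0" using that x by auto
    have pos: "0 < x \<bullet> y"
      using pos_def_matrix_inv[OF X] that by (simp add: pos_def_def y_def)
    have xx: "0 < x \<bullet> x" using that by simp
    have "0 < x \<bullet> ((mat 1 - c *\<^sub>R X) *v x)"
      using less that by (simp add: pos_def_def)
    then have l: "c * (x \<bullet> (X *v x)) < x \<bullet> x"
      by (simp add: matrix_vector_mult_diff_rdistrib inner_diff_right flip: scaleR_matrix_vector_assoc)
    have "c * (x \<bullet> x)\<^sup>2 \<le> c * ((x \<bullet> (X *v x)) * (y \<bullet> (X *v y)))"
      using pos_def_Cauchy_Schwarz[OF X, of x y] c by (intro mult_left_mono) (auto simp: x)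
    also have "\<dots> = c * (x \<bullet> (X *v x)) * (x \<bullet> y)" by (simp add: x inner_commute)
    also have "\<dots> < (x \<bullet> x) * (x \<bullet> y)"
      using l pos by (rule mult_strict_right_mono)
    finally have "c * (x \<bullet> x) < x \<bullet> y"
      using xx by (simp add: power2_eq_square mult.left_commute[of c])
    then show ?thesis
      by (simp add: matrix_vector_mult_diff_rdistrib inner_diff_right y_def flip: scaleR_matrix_vector_assoc)
  qed
  ultimately show ?thesis by (simp add: pos_def_def)
qed

text \<open>The constant is the minimum of the quadratic form on the compact unit sphere. It yields
  integrability of the kernel by comparison with an isotropic one.\<close>

lemma pos_def_coercive:
  fixes X :: "real^'n^'n"
  assumes "pos_def X"
  obtains l where "0 < l" "\<And>x. l * (x \<bullet> x) \<le> x \<bullet> (X *v x)"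
proof -
  obtain z where z: "z \<in> sphere 0 1" "\<And>y. y \<in> sphere 0 1 \<Longrightarrow> z \<bullet> (X *v z) \<le> y \<bullet> (X *v y)"
    using continuous_attains_inf[of "sphere (0::real^'n) 1" "\<lambda>x. x \<bullet> (X *v x)"]
    by (force intro!: continuous_on_inner continuous_on_id matrix_vector_mult_linear_continuous_on)
  show ?thesis
  proof
    have "z \<noteq> 0" using z by auto
    then show "0 < z \<bullet> (X *v z)" using assms by (simp add: pos_def_def)
    fix x :: "real^'n"
    show "(z \<bullet> (X *v z)) * (x \<bullet> x) \<le> x \<bullet> (X *v x)"
    proof (cases "x = 0")
      case False
      define y where "y = (1 / norm x) *\<^sub>R x"
      have "z \<bullet> (X *v z) \<le> y \<bullet> (X *v y)" using False by (intro z) (simp add: y_def)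
      also have "\<dots> = (x \<bullet> (X *v x)) / (x \<bullet> x)"
        by (simp add: y_def matrix_vector_mult_scaleR dot_square_norm power2_eq_square)
      finally show ?thesis using False by (simp add: field_simps)
    qed simp
  qed
qed

section \<open>Moments of Gaussian densities\<close>

lemma lborel_distr_reflection:
  fixes m :: "'a::euclidean_space"
  shows "distr lborel borel (\<lambda>x. m - x) = lborel"
  by (subst lborel_affine[of "-1" m]) (auto simp: density_1 distr_distr comp_def)

lemma integrable_exp_neg_inner_self:
  assumes "0 < l"
  shows "integrable lborel (\<lambda>x::'a::euclidean_space. exp (- (l * (x \<bullet> x))))"
proof (rule integrableI_nonneg)
  \<comment> \<open>Chosen so that \<open>2 * s\<^sup>2 = 1 / l\<close>, which makes each
    one-dimensional factor a multiple of a normal density.\<close>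
  define s where "s = 1 / sqrt (2 * l)"
  have s: "exp (- (l * t\<^sup>2)) = sqrt (2 * pi * s\<^sup>2) * normal_density 0 s t" for t
    using assms by (simp add: normal_density_def s_def power_divide mult.commute)
  have "integrable lborel (\<lambda>t::real. exp (- (l * t\<^sup>2)))"
    unfolding s by (intro integrable_mult_right integrable_normal_density) (use assms in \<open>simp add: s_def\<close>)
  then have fin: "(\<integral>\<^sup>+ t. ennreal (exp (- (l * t\<^sup>2))) \<partial>lborel) < \<infinity>"
    by (simp add: nn_integral_eq_integral)
  have "exp (- (l * (x \<bullet> x))) = (\<Prod>b\<in>Basis. exp (- (l * (x \<bullet> b)\<^sup>2)))" for x :: 'a
    by (subst euclidean_inner) (simp add: exp_sum[symmetric] sum_distrib_left sum_negf power2_eq_square)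
  then have "(\<integral>\<^sup>+ x. exp (- (l * (x \<bullet> (x :: 'a)))) \<partial>lborel)
      = (\<integral>\<^sup>+ x. (\<Prod>b\<in>Basis. ennreal (exp (- (l * ((x :: 'a) \<bullet> b)\<^sup>2)))) \<partial>lborel)"
    by (simp add: prod_ennreal)
  also have "\<dots> = (\<Prod>b\<in>(Basis::'a set). \<integral>\<^sup>+ t. ennreal (exp (- (l * t\<^sup>2))) \<partial>lborel)"
    by (rule nn_integral_lborel_prod) auto
  also have "\<dots> < \<infinity>"
    using fin by (simp add: power_less_top_ennreal)
  finally show "(\<integral>\<^sup>+ x. exp (- (l * (x \<bullet> (x :: 'a)))) \<partial>lborel) < \<infinity>" .
qed auto

text \<open>This is \<open>cosh x - 1 \<sim> x\<^sup>2 / 2\<close> at \<open>x = u / 2 ^ n\<close>,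
  since the square of \<open>2 ^ n\<close> is \<open>4 ^ n\<close>; evenness of \<open>cosh\<close>
  covers negative \<open>u\<close>. Steps are halved so that the doubling formula gives monotonicity
  in \<open>n\<close>.\<close>

lemma tendsto_cosh_second_difference:
  "(\<lambda>n. 4 ^ n * (cosh (u / 2 ^ n) - 1)) \<longlonglongrightarrow> (u\<^sup>2 / 2 :: real)"
proof -
  have pos: "(\<lambda>n. 4 ^ n * (cosh (u / 2 ^ n) - 1)) \<longlonglongrightarrow> u\<^sup>2 / 2" if "0 < u" for u :: real
  proof -
    have "((\<lambda>x. (cosh x - 1) / x\<^sup>2) \<longlongrightarrow> 1 / 2) (at_right (0 :: real))"
      unfolding cosh_field_def by real_asymp
    moreover have "filterlim (\<lambda>n. u / 2 ^ n) (at_right 0) sequentially"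
      using that by real_asymp
    ultimately have "(\<lambda>n. (cosh (u / 2 ^ n) - 1) / (u / 2 ^ n)\<^sup>2) \<longlonglongrightarrow> 1 / 2"
      by (rule filterlim_compose)
    then have "(\<lambda>n. u\<^sup>2 * ((cosh (u / 2 ^ n) - 1) / (u / 2 ^ n)\<^sup>2)) \<longlonglongrightarrow> u\<^sup>2 * (1 / 2)"
      by (rule tendsto_mult_left)
    moreover have "(2 ^ n)\<^sup>2 = (4 :: real) ^ n" for n :: nat
      by (simp add: power2_eq_square power_mult_distrib[symmetric])
    ultimately show ?thesis
      using that by (simp add: power_divide mult.commute)
  qed
  show ?thesis
    using pos[of u] pos[of "- u"] by (cases "u = 0"; cases "0 < u") auto
qed

text \<open>With \<open>c = cosh (u / 2 ^ Suc n)\<close>, the doubling formula gives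
  \<open>cosh (u / 2 ^ n) - 1 - 4 * (c - 1) = 2 * (c - 1)\<^sup>2\<close>, so the expression
  decreases in \<open>n\<close> from its value at 0.\<close>

lemma cosh_second_difference_le:
  "4 ^ n * (cosh (u / 2 ^ n) - 1) \<le> cosh u - (1 :: real)"
proof (induction n)
  case (Suc n)
  have "cosh (2 * (u / 2 ^ Suc n)) = 2 * (cosh (u / 2 ^ Suc n))\<^sup>2 - 1"
    by (simp only: cosh_double_cosh)
  then have eq: "cosh (u / 2 ^ n) = 2 * (cosh (u / 2 ^ Suc n))\<^sup>2 - 1" by simp
  have "0 \<le> (cosh (u / 2 ^ Suc n) - 1)\<^sup>2" by simp
  then have "4 * (cosh (u / 2 ^ Suc n) - 1) \<le> cosh (u / 2 ^ n) - 1"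
    unfolding eq by (simp add: power2_eq_square algebra_simps)
  then have "4 ^ n * (4 * (cosh (u / 2 ^ Suc n) - 1)) \<le> 4 ^ n * (cosh (u / 2 ^ n) - 1)"
    by (intro mult_left_mono) auto
  also note Suc
  finally show ?case by (simp only: power_Suc mult_ac)
qed simp

text \<open>The exponent is maximal at \<open>matrix_inv X *v t\<close>. The shift is written with
  the negated vector on the left so that it matches translation of \<open>lborel\<close> by
  \<open>(+)\<close>.\<close>

lemma gauss_kernel_shift:
  fixes X :: "real^'n^'n"
  assumes "pos_def X"
  shows "exp (t \<bullet> x - (x \<bullet> (X *v x)) / 2) = exp ((t \<bullet> (matrix_inv X *v t)) / 2) *
    exp (- (((- (matrix_inv X *v t) + x) \<bullet> (X *v (- (matrix_inv X *v t) + x))) / 2))"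
proof -
  define s where "s = matrix_inv X *v t"
  have Xs: "X *v s = t"
    by (simp add: s_def matrix_vector_mul_assoc matrix_inv_mult[OF pos_def_imp_invertible[OF assms]])
  have sx: "s \<bullet> (X *v x) = t \<bullet> x"
    using assms inner_matrix_symmetric[of X s x] by (simp add: pos_def_def Xs)
  have "(- s + x) \<bullet> (X *v (- s + x)) = t \<bullet> s - 2 * (t \<bullet> x) + x \<bullet> (X *v x)"
    using sx by (simp add: matrix_vector_mult_diff_distrib inner_diff_left inner_diff_right Xs inner_commute)
  then show ?thesis unfolding s_def[symmetric] by (simp add: exp_add[symmetric] field_simps)
qed

lemma borel_measurable_matrix_vector_mult [measurable]:
  "(\<lambda>x. (X :: real^'n^'m) *v x) \<in> borel_measurable borel"
  by (intro borel_measurable_continuous_onI matrix_vector_mult_linear_continuous_on)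

lemma integrable_gauss_kernel:
  fixes X :: "real^'n^'n"
  assumes "pos_def X"
  shows "integrable lborel (\<lambda>x. exp (- ((x \<bullet> (X *v x)) / 2)))"
proof -
  obtain l where l: "0 < l" "\<And>x. l * (x \<bullet> x) \<le> x \<bullet> (X *v x)"
    using pos_def_coercive[OF assms] by blast
  show ?thesis
  proof (rule Bochner_Integration.integrable_bound[OF integrable_exp_neg_inner_self[of "l / 2"]])
    show "AE x in lborel. norm (exp (- ((x \<bullet> (X *v x)) / 2))) \<le> norm (exp (- (l / 2 * (x \<bullet> x))))"
      using l by simp
  qed (use l in simp_all)
qed

lemma has_bochner_integral_distr_iff:
  fixes f :: "'b \<Rightarrow> 'c::{banach, second_countable_topology}"
  assumes "g \<in> measurable M N" "f \<in> borel_measurable N"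
  shows "has_bochner_integral (distr M N g) f r \<longleftrightarrow> has_bochner_integral M (\<lambda>x. f (g x)) r"
  using assms by (simp add: has_bochner_integral_iff integrable_distr_eq integral_distr)

text \<open>Completing the square turns the exponential tilt into a translation.\<close>

lemma gauss_kernel_exp_moment:
  fixes X :: "real^'n^'n"
  assumes "pos_def X"
  shows "has_bochner_integral lborel (\<lambda>x. exp (t \<bullet> x - (x \<bullet> (X *v x)) / 2))
    (exp ((t \<bullet> (matrix_inv X *v t)) / 2) * (\<integral>x. exp (- ((x \<bullet> (X *v x)) / 2)) \<partial>lborel))"
proof -
  let ?s = "matrix_inv X *v t"
  let ?g = "\<lambda>x. exp (- ((x \<bullet> (X *v x)) / 2))"
  have "has_bochner_integral (distr lborel borel ((+) (- ?s))) ?g (\<integral>x. ?g x \<partial>lborel)"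
    using integrable_gauss_kernel[OF assms] by (simp add: lborel_distr_plus has_bochner_integral_integrable)
  then have "has_bochner_integral lborel (\<lambda>x. ?g (- ?s + x)) (\<integral>x. ?g x \<partial>lborel)"
    by (subst (asm) has_bochner_integral_distr_iff) auto
  then show ?thesis
    unfolding gauss_kernel_shift[OF assms] by (rule has_bochner_integral_mult_right)
qed

text \<open>
  The second moment is the limit of the rescaled second differences \<open>4\<^sup>n (cosh (u / 2\<^sup>n) - 1)\<close> of the
  exponential moments; these decrease to \<open>u\<^sup>2 / 2\<close>, so the term \<open>n = 0\<close> dominates.
\<close>

lemma gauss_kernel_second_moment:
  fixes X :: "real^'n^'n"
  assumes "pos_def X"
  shows "has_bochner_integral lborel (\<lambda>x. (a \<bullet> x)\<^sup>2 * exp (- ((x \<bullet> (X *v x)) / 2)))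
    ((a \<bullet> (matrix_inv X *v a)) * (\<integral>x. exp (- ((x \<bullet> (X *v x)) / 2)) \<partial>lborel))"
proof -
  define g where "g x = exp (- ((x \<bullet> (X *v x)) / 2))" for x
  define v where "v = a \<bullet> (matrix_inv X *v a)"
  define Z where "Z = integral\<^sup>L lborel g"
  have g0: "0 \<le> g x" for x by (simp add: g_def)
  have [measurable]: "g \<in> borel_measurable borel" unfolding g_def by measurable
  \<comment> \<open>The mean of the exponential moments at \<open>s *\<^sub>R a\<close> and at its
    negative.\<close>
  have cosh: "has_bochner_integral lborel (\<lambda>x. cosh (s * (a \<bullet> x)) * g x) (exp (s\<^sup>2 * v / 2) * Z)" for s
  proof -
    have e: "has_bochner_integral lborel (\<lambda>x. exp (s * (a \<bullet> x)) * g x) (exp (s\<^sup>2 * v / 2) * Z)" for s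
      using gauss_kernel_exp_moment[OF assms, of "s *\<^sub>R a"]
      by (simp add: g_def[abs_def] v_def Z_def exp_add[symmetric] matrix_vector_mult_scaleR power2_eq_square mult.assoc)
    show ?thesis
      using has_bochner_integral_divide_zero[OF has_bochner_integral_add[OF e[of s] e[of "- s"]], of 2]
      by (simp add: cosh_field_def add_divide_distrib distrib_right mult.commute[of Z])
  qed
  \<comment> \<open>Here \<open>cosh[of 0]\<close> is the plain mass \<open>Z\<close>, subtracted to
    form the second difference.\<close>
  have diff: "has_bochner_integral lborel (\<lambda>x. (4 ^ n * (cosh ((a \<bullet> x) / 2 ^ n) - 1)) * g x)
      ((4 ^ n * (exp (v / 4 ^ n / 2) - 1)) * Z)" for n
  proof -
    have "((1 / 2 ^ n)\<^sup>2 :: real) = 1 / 4 ^ n"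
      by (simp add: power2_eq_square power_mult_distrib[symmetric])
    then show ?thesis
    using has_bochner_integral_mult_right[OF has_bochner_integral_diff[OF cosh[of "1 / 2 ^ n"] cosh[of 0]], of "4 ^ n"]
    by (simp add: algebra_simps)
  qed
  have dom: "integrable lborel (\<lambda>x. (cosh (a \<bullet> x) - 1) * g x)"
    using diff[of 0] by (simp add: has_bochner_integral_iff)
  have lim: "(\<lambda>n. (4 ^ n * (cosh ((a \<bullet> x) / 2 ^ n) - 1)) * g x) \<longlonglongrightarrow> (a \<bullet> x)\<^sup>2 / 2 * g x" for x
    by (intro tendsto_intros tendsto_cosh_second_difference)
  have bound: "norm ((4 ^ n * (cosh ((a \<bullet> x) / 2 ^ n) - 1)) * g x) \<le> (cosh (a \<bullet> x) - 1) * g x" for n x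
    using cosh_second_difference_le[of n "a \<bullet> x"] cosh_real_ge_1[of "(a \<bullet> x) / 2 ^ n"] g0[of x]
    by (auto simp: abs_mult mult_right_mono)
  have meas: "(\<lambda>x. (4 ^ n * (cosh ((a \<bullet> x) / 2 ^ n) - 1)) * g x) \<in> borel_measurable lborel" for n
    using diff[of n] by (rule borel_measurable_has_bochner_integral)
  have int: "integrable lborel (\<lambda>x. (a \<bullet> x)\<^sup>2 / 2 * g x)"
    by (rule integrable_dominated_convergence[where s="\<lambda>n x. (4 ^ n * (cosh ((a \<bullet> x) / 2 ^ n) - 1)) * g x", OF _ meas dom])
      (use lim bound in auto)
  have "(\<lambda>n. integral\<^sup>L lborel (\<lambda>x. (4 ^ n * (cosh ((a \<bullet> x) / 2 ^ n) - 1)) * g x))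
      \<longlonglongrightarrow> integral\<^sup>L lborel (\<lambda>x. (a \<bullet> x)\<^sup>2 / 2 * g x)"
    by (rule integral_dominated_convergence[where s="\<lambda>n x. (4 ^ n * (cosh ((a \<bullet> x) / 2 ^ n) - 1)) * g x", OF _ meas dom])
      (use lim bound in auto)
  then have "(\<lambda>n. (4 ^ n * (exp (v / 4 ^ n / 2) - 1)) * Z) \<longlonglongrightarrow> integral\<^sup>L lborel (\<lambda>x. (a \<bullet> x)\<^sup>2 / 2 * g x)"
    using diff by (simp add: has_bochner_integral_iff)
  \<comment> \<open>This is the derivative of \<open>exp\<close> at 0, along the increments
    \<open>v / (2 * 4 ^ n)\<close>.\<close>
  moreover have "(\<lambda>n. (4 ^ n * (exp (v / 4 ^ n / 2) - 1)) * Z) \<longlonglongrightarrow> v / 2 * Z"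
    by (intro tendsto_intros) real_asymp
  ultimately have "integral\<^sup>L lborel (\<lambda>x. (a \<bullet> x)\<^sup>2 / 2 * g x) = v / 2 * Z"
    by (rule LIMSEQ_unique)
  with int have "has_bochner_integral lborel (\<lambda>x. 2 * ((a \<bullet> x)\<^sup>2 / 2 * g x)) (2 * (v / 2 * Z))"
    by (intro has_bochner_integral_mult_right) (simp add: has_bochner_integral_iff)
  then show ?thesis by (simp add: g_def[abs_def] v_def Z_def)
qed

lemma inner_axis_matrix_vector_mult: "axis i 1 \<bullet> ((X :: real^'n^'m) *v axis j 1) = X $ i $ j"
  by (simp add: inner_axis' matrix_vector_mult_basis column_def)

lemma borel_measurable_vec_nth [measurable]: "(\<lambda>x :: real^'n. x $ i) \<in> borel_measurable borel"
  by (intro borel_measurable_continuous_onI continuous_intros)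

section \<open>Square integrability, and mean and covariance tested along directions\<close>

lemma (in finite_measure) integrable_if_square_integrable:
  fixes X :: "'a \<Rightarrow> 'b::{second_countable_topology, banach}"
  assumes [measurable]: "X \<in> borel_measurable M" and "integrable M (\<lambda>x. (norm (X x))\<^sup>2)"
  shows "integrable M X"
proof (rule Bochner_Integration.integrable_bound)
  show "integrable M (\<lambda>x. 1 + (norm (X x))\<^sup>2)" using assms by auto
  have "t \<le> 1 + t\<^sup>2" for t :: real
    using zero_le_power2[of "t - 1"] zero_le_power2[of t] unfolding power2_diff one_power2 mult_1_right by linarith
  then show "AE x in M. norm (X x) \<le> norm (1 + (norm (X x))\<^sup>2)" by (simp add: abs_of_nonneg)
qed simp

lemma integrable_mult_if_square_integrable:
  fixes f g :: "'a \<Rightarrow> real"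
  assumes [measurable]: "f \<in> borel_measurable M" "g \<in> borel_measurable M"
    and "integrable M (\<lambda>x. (f x)\<^sup>2)" "integrable M (\<lambda>x. (g x)\<^sup>2)"
  shows "integrable M (\<lambda>x. f x * g x)"
proof (rule Bochner_Integration.integrable_bound)
  show "integrable M (\<lambda>x. (f x)\<^sup>2 + (g x)\<^sup>2)" using assms by auto
  have "\<bar>s * t\<bar> \<le> s\<^sup>2 + t\<^sup>2" for s t :: real
    using zero_le_power2[of "\<bar>s\<bar> - \<bar>t\<bar>"] zero_le_power2[of s] zero_le_power2[of t] unfolding power2_diff abs_mult power2_abs by linarith
  then show "AE x in M. norm (f x * g x) \<le> norm ((f x)\<^sup>2 + (g x)\<^sup>2)" by simp
qed simp

lemma norm_vec_power2: "(norm (x :: real^'n))\<^sup>2 = (\<Sum>i\<in>UNIV. (x $ i)\<^sup>2)"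
  unfolding power2_norm_eq_inner inner_vec_def by (simp add: power2_eq_square)

text \<open>Entry \<open>(i, j)\<close> of the covariance comes from the directions
  \<open>axis i 1\<close>, \<open>axis j 1\<close> and their sum by polarization. A quadratic form
  determines only the symmetric part of \<open>P\<close>, whence the symmetry condition. The mass
  \<open>z\<close> appears since the law is not normalized.\<close>

lemma has_mean_covI:
  fixes \<nu> :: "(real^'n) measure"
  assumes sets: "sets \<nu> = sets borel"
    and mass: "has_bochner_integral \<nu> (\<lambda>_. 1) z" "0 < z"
    and mean: "\<And>a. has_bochner_integral \<nu> (\<lambda>x. a \<bullet> (x - m)) 0"
    and cov: "\<And>a. has_bochner_integral \<nu> (\<lambda>x. (a \<bullet> (x - m))\<^sup>2) (z * (a \<bullet> (P *v a)))"
    and sym: "transpose P = P"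
  shows "has_mean_cov \<nu> m P"
proof -
  note [measurable_cong] = sets
  have space: "space \<nu> = UNIV" using sets_eq_imp_space_eq[OF sets] by simp
  have "emeasure \<nu> UNIV < \<infinity>"
    using mass(1) by (simp add: has_bochner_integral_iff integrable_iff_bounded space[symmetric])
  then interpret finite_measure \<nu> by (intro finite_measureI) (simp add: space)
  have z: "measure \<nu> UNIV = z"
    using mass(1) by (simp add: has_bochner_integral_iff space)
  have "integrable \<nu> (\<lambda>x. \<Sum>i\<in>UNIV. (axis i 1 \<bullet> (x - m))\<^sup>2)"
    using cov by (intro Bochner_Integration.integrable_sum) (auto simp: has_bochner_integral_iff)
  then have int2: "integrable \<nu> (\<lambda>x. (norm (x - m))\<^sup>2)"
    by (simp add: norm_vec_power2 inner_axis')
  have int2': "integrable \<nu> (\<lambda>x. (norm x)\<^sup>2)"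
  proof (rule Bochner_Integration.integrable_bound)
    show "integrable \<nu> (\<lambda>x. 2 * (norm (x - m))\<^sup>2 + 2 * (norm m)\<^sup>2)" using int2 by auto
    have "(norm x)\<^sup>2 \<le> 2 * (norm (x - m))\<^sup>2 + 2 * (norm m)\<^sup>2" for x
    proof -
      have "norm x \<le> norm (x - m) + norm m" using norm_triangle_ineq[of "x - m" m] by simp
      then have "(norm x)\<^sup>2 \<le> (norm (x - m) + norm m)\<^sup>2" by (intro power_mono) auto
      also have "\<dots> \<le> 2 * (norm (x - m))\<^sup>2 + 2 * (norm m)\<^sup>2"
        using zero_le_power2[of "norm (x - m) - norm m"] by (simp add: power2_sum power2_diff)
      finally show ?thesis .
    qed
    then show "AE x in \<nu>. norm ((norm x)\<^sup>2) \<le> norm (2 * (norm (x - m))\<^sup>2 + 2 * (norm m)\<^sup>2)"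
      by (simp add: abs_of_nonneg)
  qed simp
  then have int1: "integrable \<nu> (\<lambda>x. x)" by (rule integrable_if_square_integrable[rotated]) simp
  have "(\<integral>x. x \<partial>\<nu>) $ i = z * m $ i" for i
  proof -
    have "(\<integral>x. x \<partial>\<nu>) $ i = (\<integral>x. axis i 1 \<bullet> (x - m) + m $ i \<partial>\<nu>)"
      using int1 by (simp add: inner_axis' integral_bounded_linear[OF bounded_linear_vec_nth])
    also have "\<dots> = z * m $ i"
      using mean[of "axis i 1"] by (subst Bochner_Integration.integral_add) (auto simp: has_bochner_integral_iff space z)
    finally show ?thesis .
  qed
  then have "m = (1 / measure \<nu> UNIV) *\<^sub>R (\<integral>x. x \<partial>\<nu>)"
    using mass(2) by (simp add: vec_eq_iff z)
  moreover have "(\<integral>x. (x - m) $ i * (x - m) $ j \<partial>\<nu>) = z * P $ i $ j" for i j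
  proof -
    have P: "axis i 1 \<bullet> (P *v axis j 1) = P $ i $ j" "axis j 1 \<bullet> (P *v axis i 1) = P $ i $ j"
      using sym unfolding inner_axis_matrix_vector_mult by (auto simp: transpose_def vec_eq_iff)
    let ?q = "\<lambda>a x. (a \<bullet> (x - m))\<^sup>2"
    have "has_bochner_integral \<nu> (\<lambda>x. (?q (axis i 1 + axis j 1) x - ?q (axis i 1) x - ?q (axis j 1) x) / 2)
      ((z * ((axis i 1 + axis j 1) \<bullet> (P *v (axis i 1 + axis j 1))) - z * (axis i 1 \<bullet> (P *v axis i 1))
         - z * (axis j 1 \<bullet> (P *v axis j 1))) / 2)"
      by (intro has_bochner_integral_divide_zero has_bochner_integral_diff cov)
    moreover have "(?q (axis i 1 + axis j 1) x - ?q (axis i 1) x - ?q (axis j 1) x) / 2 = (x - m) $ i * (x - m) $ j" for x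
      by (simp add: inner_axis' inner_add_left power2_sum)
    moreover have "(z * ((axis i 1 + axis j 1) \<bullet> (P *v (axis i 1 + axis j 1))) - z * (axis i 1 \<bullet> (P *v axis i 1))
         - z * (axis j 1 \<bullet> (P *v axis j 1))) / 2 = z * P $ i $ j"
      by (simp add: P matrix_vector_right_distrib inner_add_left inner_add_right distrib_left)
    ultimately have "has_bochner_integral \<nu> (\<lambda>x. (x - m) $ i * (x - m) $ j) (z * P $ i $ j)"
      by (simp only:)
    then show ?thesis by (simp add: has_bochner_integral_iff)
  qed
  then have "P = (1 / measure \<nu> UNIV) *\<^sub>R (\<chi> i j. \<integral>x. (x - m) $ i * (x - m) $ j \<partial>\<nu>)"
    using mass(2) by (simp add: vec_eq_iff z)
  ultimately show ?thesis
    unfolding has_mean_cov_def using sets finite_measure_axioms mass(2) z int2' by blast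
qed

text \<open>The converse direction: square integrability of \<open>norm x\<close> controls every
  product of centred components, and \<open>(a \<bullet> (x - m))\<^sup>2\<close> is a finite double
  sum of such products.\<close>

lemma has_mean_covD:
  fixes \<nu> :: "(real^'n) measure"
  assumes "has_mean_cov \<nu> m P"
  shows "has_bochner_integral \<nu> (\<lambda>x. a \<bullet> (x - m)) 0"
    and "has_bochner_integral \<nu> (\<lambda>x. (a \<bullet> (x - m))\<^sup>2) (measure \<nu> UNIV * (a \<bullet> (P *v a)))"
    and "transpose P = P"
proof -
  note h = assms[unfolded has_mean_cov_def]
  note [measurable_cong] = h[THEN conjunct1]
  have space: "space \<nu> = UNIV" using sets_eq_imp_space_eq[of \<nu> borel] h by simp
  interpret finite_measure \<nu> using h by blast
  define z where "z = measure \<nu> UNIV"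
  have z: "0 < z" using h by (simp add: z_def)
  have int2: "integrable \<nu> (\<lambda>x. (norm x)\<^sup>2)" using h by blast
  then have int1: "integrable \<nu> (\<lambda>x. x)" by (rule integrable_if_square_integrable[rotated]) simp
  have "m = (1 / measure \<nu> UNIV) *\<^sub>R (\<integral>x. x \<partial>\<nu>)" using h by blast
  then have m: "(\<integral>x. x \<partial>\<nu>) = z *\<^sub>R m" using z by (simp add: z_def)
  have "P = (1 / measure \<nu> UNIV) *\<^sub>R (\<chi> i j. \<integral>x. (x - m) $ i * (x - m) $ j \<partial>\<nu>)" using h by blast
  then have P: "P $ i $ j = (1 / z) * (\<integral>x. (x - m) $ i * (x - m) $ j \<partial>\<nu>)" for i j
    by (subst \<open>P = _\<close>) (simp add: z_def)
  then show "transpose P = P" by (simp add: transpose_def vec_eq_iff mult.commute)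
  show "has_bochner_integral \<nu> (\<lambda>x. a \<bullet> (x - m)) 0"
    using int1 m by (simp add: has_bochner_integral_iff space z_def)
  have sq: "integrable \<nu> (\<lambda>x. ((x - m) $ i)\<^sup>2)" for i
  proof (rule Bochner_Integration.integrable_bound)
    show "integrable \<nu> (\<lambda>x. (norm x)\<^sup>2 - 2 * (x \<bullet> m) + (norm m)\<^sup>2)" using int1 int2 by auto
    have "((x - m) $ i)\<^sup>2 \<le> (norm x)\<^sup>2 - 2 * (x \<bullet> m) + (norm m)\<^sup>2" for x
    proof -
      have "\<bar>(x - m) $ i\<bar>\<^sup>2 \<le> (norm (x - m))\<^sup>2" by (intro power_mono component_le_norm_cart) auto
      also have "\<dots> = (norm x)\<^sup>2 - 2 * (x \<bullet> m) + (norm m)\<^sup>2"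
        by (simp add: power2_norm_eq_inner inner_diff_left inner_diff_right inner_commute)
      finally show ?thesis by simp
    qed
    then show "AE x in \<nu>. norm (((x - m) $ i)\<^sup>2) \<le> norm ((norm x)\<^sup>2 - 2 * (x \<bullet> m) + (norm m)\<^sup>2)"
      by (smt (verit) AE_I2 real_norm_def zero_le_power2)
  qed measurable
  have "has_bochner_integral \<nu> (\<lambda>x. (x - m) $ i * (x - m) $ j) (z * P $ i $ j)" for i j
    using integrable_mult_if_square_integrable[OF _ _ sq[of i] sq[of j]] z
    by (simp add: P has_bochner_integral_iff)
  then have "has_bochner_integral \<nu> (\<lambda>x. \<Sum>i\<in>UNIV. \<Sum>j\<in>UNIV. a $ i * a $ j * ((x - m) $ i * (x - m) $ j))
      (\<Sum>i\<in>UNIV. \<Sum>j\<in>UNIV. a $ i * a $ j * (z * P $ i $ j))"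
    by (intro has_bochner_integral_sum has_bochner_integral_mult_right)
  moreover have "(\<Sum>i\<in>UNIV. \<Sum>j\<in>UNIV. a $ i * a $ j * (u $ i * u $ j)) = (a \<bullet> u)\<^sup>2" for u
    by (simp add: power2_eq_square inner_vec_def sum_product mult_ac)
  moreover have "(\<Sum>i\<in>UNIV. \<Sum>j\<in>UNIV. a $ i * a $ j * (z * P $ i $ j)) = z * (a \<bullet> (P *v a))"
    by (simp add: inner_vec_def matrix_vector_mult_def sum_distrib_left mult_ac)
  ultimately show "has_bochner_integral \<nu> (\<lambda>x. (a \<bullet> (x - m))\<^sup>2) (measure \<nu> UNIV * (a \<bullet> (P *v a)))"
    by (simp add: z_def del: vector_minus_component)
qed

text \<open>The integrand is odd, so reflection equates its integral with the negative;
  integrability follows from the zeroth and second moments through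
  \<open>\<bar>t\<bar> \<le> 1 + t\<^sup>2\<close>.\<close>

lemma gauss_kernel_first_moment:
  fixes X :: "real^'n^'n"
  assumes "pos_def X"
  shows "has_bochner_integral lborel (\<lambda>x. (a \<bullet> x) * exp (- ((x \<bullet> (X *v x)) / 2))) 0"
proof -
  let ?f = "\<lambda>x. (a \<bullet> x) * exp (- ((x \<bullet> (X *v x)) / 2))"
  have int: "integrable lborel ?f"
  proof (rule Bochner_Integration.integrable_bound)
    show "integrable lborel (\<lambda>x. exp (- ((x \<bullet> (X *v x)) / 2)) + (a \<bullet> x)\<^sup>2 * exp (- ((x \<bullet> (X *v x)) / 2)))"
      using integrable_gauss_kernel[OF assms] gauss_kernel_second_moment[OF assms]
      by (auto simp: has_bochner_integral_iff)
    have t: "\<bar>t\<bar> \<le> 1 + t\<^sup>2" for t :: real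
      using zero_le_power2[of "\<bar>t\<bar> - 1"] zero_le_power2[of t] unfolding power2_diff power2_abs one_power2 mult_1_right by linarith
    have "\<bar>a \<bullet> x\<bar> * e \<le> e + (a \<bullet> x)\<^sup>2 * e" if "0 \<le> e" for e x
      using mult_right_mono[OF t[of "a \<bullet> x"] that] by (simp add: distrib_right)
    then show "AE x in lborel. norm (?f x) \<le> norm (exp (- ((x \<bullet> (X *v x)) / 2)) + (a \<bullet> x)\<^sup>2 * exp (- ((x \<bullet> (X *v x)) / 2)))"
      by (simp add: abs_mult abs_of_nonneg)
  qed measurable
  have "integral\<^sup>L lborel ?f = integral\<^sup>L (distr lborel borel (\<lambda>x. 0 - x)) ?f"
    by (simp only: lborel_distr_reflection)
  also have "\<dots> = - integral\<^sup>L lborel ?f"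
    by (subst integral_distr) (auto simp: linear_neg[OF matrix_vector_mul_linear])
  finally show ?thesis using int by (simp add: has_bochner_integral_iff)
qed

section \<open>Unnormalized Gaussian measures: kernel form, moments and weighting\<close>

lemma gauss_density_eq:
  fixes P :: "real^'n^'n"
  assumes "pos_def P"
  obtains C where "0 < C"
    "\<And>x. gauss_density m P x = C * exp (- (((x - m) \<bullet> (matrix_inv P *v (x - m))) / 2))"
  using pos_def_imp_det_pos[OF assms]
  by (intro that[of "1 / sqrt ((2 * pi) ^ CARD('n) * det P)"]) (auto simp: gauss_density_def)

text \<open>The positive normalizing constant is absorbed into \<open>c\<close>. Hence a change of
  covariance under weighting needs no comparison of determinants.\<close>

lemma unnormalized_gaussian_iff:
  fixes \<nu> :: "(real^'n) measure"
  shows "unnormalized_gaussian \<nu> m P \<longleftrightarrow> pos_def P \<and>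
    (\<exists>c>0. \<nu> = density lborel (\<lambda>x. ennreal (c * exp (- (((x - m) \<bullet> (matrix_inv P *v (x - m))) / 2)))))"
proof (cases "pos_def P")
  case True
  obtain C where C: "0 < C"
    "\<And>x. gauss_density m P x = C * exp (- (((x - m) \<bullet> (matrix_inv P *v (x - m))) / 2))"
    using gauss_density_eq[OF True] by metis
  show ?thesis
    unfolding unnormalized_gaussian_def C(2)
  proof (intro conj_cong refl iffI; elim exE conjE)
    fix c :: real
    assume "0 < c" "\<nu> = density lborel (\<lambda>x. ennreal (c * (C * exp (- (((x - m) \<bullet> (matrix_inv P *v (x - m))) / 2)))))"
    then show "\<exists>c>0. \<nu> = density lborel (\<lambda>x. ennreal (c * exp (- (((x - m) \<bullet> (matrix_inv P *v (x - m))) / 2))))"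
      using C(1) by (intro exI[of _ "c * C"]) (simp add: mult.assoc)
  next
    fix c :: real
    assume "0 < c" "\<nu> = density lborel (\<lambda>x. ennreal (c * exp (- (((x - m) \<bullet> (matrix_inv P *v (x - m))) / 2))))"
    then show "\<exists>c>0. \<nu> = density lborel (\<lambda>x. ennreal (c * (C * exp (- (((x - m) \<bullet> (matrix_inv P *v (x - m))) / 2)))))"
      using C(1) by (intro exI[of _ "c / C"]) simp
  qed
qed (simp add: unnormalized_gaussian_def)

lemma unnormalized_gaussian_has_mean_cov:
  fixes \<nu> :: "(real^'n) measure"
  assumes "unnormalized_gaussian \<nu> m P"
  shows "has_mean_cov \<nu> m P"
proof -
  define X where "X = matrix_inv P"
  define g where "g x = exp (- ((x \<bullet> (X *v x)) / 2))" for x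
  define Z where "Z = integral\<^sup>L lborel g"
  have P: "pos_def P" using assms by (simp add: unnormalized_gaussian_def)
  then have X: "pos_def X" by (simp add: X_def pos_def_matrix_inv)
  have invX: "matrix_inv X = P"
    using matrix_inv_mult[OF pos_def_imp_invertible[OF P]] by (auto simp: X_def intro: matrix_inv_eqI)
  obtain c where c: "0 < c" and \<nu>: "\<nu> = density lborel (\<lambda>x. ennreal (c * g (x - m)))"
    using assms unfolding unnormalized_gaussian_iff g_def X_def by blast
  have [measurable]: "g \<in> borel_measurable borel" unfolding g_def by measurable
  \<comment> \<open>Translation by \<open>m\<close> reduces every moment of the measure to one of
    the centred kernel.\<close>
  have shift: "has_bochner_integral \<nu> (\<lambda>x. f (x - m)) (c * r)"
    if f[measurable]: "f \<in> borel_measurable borel" and r: "has_bochner_integral lborel (\<lambda>u. f u * g u) r"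
    for f :: "real^'n \<Rightarrow> real" and r
  proof -
    have "has_bochner_integral (distr lborel borel ((+) (- m))) (\<lambda>u. c * (f u * g u)) (c * r)"
      using r by (intro has_bochner_integral_mult_right) (simp add: lborel_distr_plus)
    then have "has_bochner_integral lborel (\<lambda>x. (c * g (x - m)) *\<^sub>R f (x - m)) (c * r)"
      by (subst (asm) has_bochner_integral_distr_iff) (auto simp: mult_ac)
    then show ?thesis
      unfolding \<nu> using c by (intro has_bochner_integral_density) (auto simp: g_def)
  qed
  have Zint: "integrable lborel g" using integrable_gauss_kernel[OF X] by (simp add: g_def[abs_def])
  \<comment> \<open>The kernel is positive everywhere, so a zero integral would make Lebesgue
    measure itself null.\<close>
  have "Z \<noteq> 0"
  proof
    assume "Z = 0"
    then have "AE x in lborel. g x = 0"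
      using integral_nonneg_eq_0_iff_AE[OF Zint] by (simp add: Z_def g_def)
    then have "AE x in (lborel :: (real^'n) measure). False" by (simp add: g_def)
    then show False by (simp add: AE_iff_null null_sets_def)
  qed
  moreover have "0 \<le> Z" unfolding Z_def by (rule integral_nonneg_AE) (simp add: g_def)
  ultimately have Z: "0 < Z" by simp
  show ?thesis
  proof (rule has_mean_covI)
    show "has_bochner_integral \<nu> (\<lambda>_. 1) (c * Z)"
      using shift[of "\<lambda>_. 1" Z] Zint by (simp add: Z_def has_bochner_integral_iff)
    show "has_bochner_integral \<nu> (\<lambda>x. a \<bullet> (x - m)) 0" for a
      using shift[of "\<lambda>u. a \<bullet> u" 0] gauss_kernel_first_moment[OF X, of a] by (simp add: g_def)
    show "has_bochner_integral \<nu> (\<lambda>x. (a \<bullet> (x - m))\<^sup>2) (c * Z * (a \<bullet> (P *v a)))" for a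
      using shift[of "\<lambda>u. (a \<bullet> u)\<^sup>2", OF _ gauss_kernel_second_moment[OF X, of a, folded g_def]]
      by (simp add: invX Z_def mult_ac)
    show "transpose P = P" using P by (simp add: pos_def_def)
  qed (use c Z in \<open>auto simp: \<nu>\<close>)
qed

text \<open>The weight is centred at the mean of the Gaussian, so both exponents are pure quadratic
  forms in \<open>x - m\<close> and simply add up. The bound on \<open>\<mu>\<close> keeps the
  resulting form positive definite.\<close>

lemma unnormalized_gaussian_tilt:
  fixes \<nu> :: "(real^'n) measure"
  assumes \<nu>: "unnormalized_gaussian \<nu> m P" and less: "pos_def (mat 1 - (2 * \<mu>) *\<^sub>R P)" and \<mu>: "0 \<le> \<mu>"
  shows "unnormalized_gaussian (density \<nu> (\<lambda>x. ennreal (exp (\<mu> * ((x - m) \<bullet> (x - m)))))) m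
    (matrix_inv (matrix_inv P - (2 * \<mu>) *\<^sub>R mat 1))"
proof -
  define X where "X = matrix_inv P - (2 * \<mu>) *\<^sub>R mat 1"
  obtain c where P: "pos_def P" and c: "0 < c"
    and eq: "\<nu> = density lborel (\<lambda>x. ennreal (c * exp (- (((x - m) \<bullet> (matrix_inv P *v (x - m))) / 2))))"
    using \<nu> unfolding unnormalized_gaussian_iff by blast
  have X: "pos_def X"
    unfolding X_def using P less \<mu> by (intro pos_def_matrix_inv_minus_scaled_mat) auto
  have inv: "matrix_inv (matrix_inv X) = X"
    using matrix_inv_mult[OF pos_def_imp_invertible[OF X]] by (auto intro: matrix_inv_eqI)
  have "c * exp (- ((u \<bullet> (matrix_inv P *v u)) / 2)) * exp (\<mu> * (u \<bullet> u)) = c * exp (- ((u \<bullet> (X *v u)) / 2))" for u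
    by (simp add: X_def matrix_vector_mult_diff_rdistrib inner_diff_right exp_add[symmetric] field_simps
        flip: scaleR_matrix_vector_assoc)
  then have "density \<nu> (\<lambda>x. ennreal (exp (\<mu> * ((x - m) \<bullet> (x - m)))))
    = density lborel (\<lambda>x. ennreal (c * exp (- (((x - m) \<bullet> (X *v (x - m))) / 2))))"
    unfolding eq using c by (subst density_density_eq) (auto simp: ennreal_mult[symmetric] mult.assoc)
  then show ?thesis
    unfolding unnormalized_gaussian_iff X_def[symmetric] inv
    using c pos_def_matrix_inv[OF X] by blast
qed

section \<open>Propagation of moments through a transition\<close>

lemma has_bochner_integral_pair_mult:
  fixes f :: "'a \<Rightarrow> real" and g :: "'b \<Rightarrow> real"
  assumes "sigma_finite_measure M1" "sigma_finite_measure M2"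
    and f: "has_bochner_integral M1 f r" and g: "has_bochner_integral M2 g s"
  shows "has_bochner_integral (M1 \<Otimes>\<^sub>M M2) (\<lambda>z. f (fst z) * g (snd z)) (r * s)"
proof -
  interpret M1: sigma_finite_measure M1 by fact
  interpret M2: sigma_finite_measure M2 by fact
  interpret pair_sigma_finite M1 M2 ..
  have fi: "integrable M1 f" "integral\<^sup>L M1 f = r" and gi: "integrable M2 g" "integral\<^sup>L M2 g = s"
    using f g by (auto simp: has_bochner_integral_iff)
  note [measurable] = borel_measurable_integrable[OF fi(1)] borel_measurable_integrable[OF gi(1)]
  have int: "integrable (M1 \<Otimes>\<^sub>M M2) (\<lambda>z. f (fst z) * g (snd z))"
  proof (rule Fubini_integrable)
    show "integrable M1 (\<lambda>x. \<integral>y. norm (f (fst (x, y)) * g (snd (x, y))) \<partial>M2)"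
      using fi by (simp add: abs_mult)
    show "AE x in M1. integrable M2 (\<lambda>y. f (fst (x, y)) * g (snd (x, y)))"
      using gi by simp
  qed measurable
  then show ?thesis
    using integral_fst'[OF int] fi gi by (simp add: has_bochner_integral_iff)
qed

text \<open>Every kernel \<open>distr M N (T \<xi>)\<close> draws its randomness from the same
  \<open>M\<close>, so mixing over \<open>\<xi>\<close> is an image of the product measure.
  Integrals of signed functions against the bind thereby become accessible to Fubini.\<close>

lemma bind_distr_eq_distr_pair:
  assumes "sigma_finite_measure M" and T: "case_prod T \<in> measurable (\<nu> \<Otimes>\<^sub>M M) N"
    and ne: "space \<nu> \<noteq> {}"
    and meas: "(\<lambda>\<xi>. distr M N (T \<xi>)) \<in> measurable \<nu> (subprob_algebra N)"
  shows "\<nu> \<bind> (\<lambda>\<xi>. distr M N (T \<xi>)) = distr (\<nu> \<Otimes>\<^sub>M M) N (case_prod T)"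
proof (rule measure_eqI)
  interpret sigma_finite_measure M by fact
  note [measurable] = T
  show sets: "sets (\<nu> \<bind> (\<lambda>\<xi>. distr M N (T \<xi>))) = sets (distr (\<nu> \<Otimes>\<^sub>M M) N (case_prod T))"
    by (subst sets_bind[where N=N]) (use ne in auto)
  fix C assume "C \<in> sets (\<nu> \<bind> (\<lambda>\<xi>. distr M N (T \<xi>)))"
  then have [measurable]: "C \<in> sets N" using sets by simp
  have "emeasure (\<nu> \<bind> (\<lambda>\<xi>. distr M N (T \<xi>))) C = (\<integral>\<^sup>+ \<xi>. emeasure (distr M N (T \<xi>)) C \<partial>\<nu>)"
    by (rule emeasure_bind[OF ne meas]) measurable
  also have "\<dots> = (\<integral>\<^sup>+ \<xi>. emeasure M (Pair \<xi> -` (case_prod T -` C \<inter> space (\<nu> \<Otimes>\<^sub>M M))) \<partial>\<nu>)"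
  proof (intro nn_integral_cong)
    fix \<xi> assume \<xi>: "\<xi> \<in> space \<nu>"
    then have "T \<xi> \<in> measurable M N" using measurable_Pair2[OF T \<xi>] by simp
    then show "emeasure (distr M N (T \<xi>)) C = emeasure M (Pair \<xi> -` (case_prod T -` C \<inter> space (\<nu> \<Otimes>\<^sub>M M)))"
      using \<xi> by (subst emeasure_distr) (auto simp: space_pair_measure intro!: arg_cong[where f="emeasure M"])
  qed
  also have "\<dots> = emeasure (\<nu> \<Otimes>\<^sub>M M) (case_prod T -` C \<inter> space (\<nu> \<Otimes>\<^sub>M M))"
    by (rule emeasure_pair_measure_alt[symmetric]) measurable
  also have "\<dots> = emeasure (distr (\<nu> \<Otimes>\<^sub>M M) N (case_prod T)) C"
    by (rule emeasure_distr[symmetric]) measurable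
  finally show "emeasure (\<nu> \<bind> (\<lambda>\<xi>. distr M N (T \<xi>))) C = emeasure (distr (\<nu> \<Otimes>\<^sub>M M) N (case_prod T)) C" .
qed

lemma transpose_add: "transpose (X + Y) = transpose X + transpose (Y :: real^'n^'m)"
  by (simp add: transpose_def vec_eq_iff)

lemma (in prob_space) measurable_transition:
  fixes F :: "real^'n^'n"
  assumes [measurable]: "\<eta> k \<in> borel_measurable M"
  shows "transition M F \<eta> k \<in> borel \<rightarrow>\<^sub>M subprob_algebra borel"
proof -
  interpret \<eta>: prob_space "distr M borel (\<eta> k)" by (rule prob_space_distr) measurable
  have "(\<lambda>\<xi>. distr (distr M borel (\<eta> k)) borel (\<lambda>u. F *v \<xi> + u)) \<in> borel \<rightarrow>\<^sub>M subprob_algebra borel"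
    by (rule measurable_distr2[where M=borel])
      (auto intro!: measurable_const simp: space_subprob_algebra \<eta>.subprob_space_axioms)
  then show ?thesis
    unfolding transition_def by (subst (asm) distr_distr) (auto simp: comp_def)
qed

text \<open>On the product space the state and the disturbance are independent, and the mixed term
  of the square is a product of two vanishing first moments. The mass \<open>z\<close> of the input
  law is kept, as \<open>M\<close> has mass 1.\<close>

lemma (in prob_space) has_mean_cov_bind_transition:
  fixes F C D :: "real^'n^'n"
  assumes \<nu>: "has_mean_cov \<nu> m C"
    and \<eta>: "\<eta> k \<in> borel_measurable M"
    and mean: "\<And>a. has_bochner_integral M (\<lambda>\<omega>. a \<bullet> \<eta> k \<omega>) 0"
    and cov: "\<And>a. has_bochner_integral M (\<lambda>\<omega>. (a \<bullet> \<eta> k \<omega>)\<^sup>2) (a \<bullet> (D *v a))"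
    and D: "transpose D = D"
  shows "has_mean_cov (\<nu> \<bind> transition M F \<eta> k) (F *v m) (F ** C ** transpose F + D)"
proof -
  note [measurable] = \<eta>
  have sets[measurable_cong]: "sets \<nu> = sets borel" and fin: "finite_measure \<nu>" and pos: "0 < measure \<nu> UNIV"
    using \<nu> by (auto simp: has_mean_cov_def)
  have space: "space \<nu> = UNIV" using sets_eq_imp_space_eq[OF sets] by simp
  interpret \<nu>: finite_measure \<nu> by fact
  note sf = \<nu>.sigma_finite_measure_axioms sigma_finite_measure_axioms
  define z where "z = measure \<nu> UNIV"
  define T where "T = (\<lambda>\<xi> \<omega>. F *v \<xi> + \<eta> k \<omega>)"
  have [measurable]: "case_prod T \<in> borel_measurable (\<nu> \<Otimes>\<^sub>M M)"
    unfolding T_def by measurable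
  have one\<nu>: "has_bochner_integral \<nu> (\<lambda>_. 1) z"
    by (simp add: has_bochner_integral_iff z_def space)
  have oneM: "has_bochner_integral M (\<lambda>_. 1) (1 :: real)"
    by (simp add: has_bochner_integral_iff prob_space)
  have "(\<lambda>\<xi>. distr M borel (T \<xi>)) \<in> borel \<rightarrow>\<^sub>M subprob_algebra borel"
    using measurable_transition[of \<eta> k F] by (simp add: transition_def[abs_def] T_def)
  then have "(\<lambda>\<xi>. distr M borel (T \<xi>)) \<in> \<nu> \<rightarrow>\<^sub>M subprob_algebra borel"
    by (simp add: measurable_cong_sets[OF sets refl])
  then have bind: "\<nu> \<bind> transition M F \<eta> k = distr (\<nu> \<Otimes>\<^sub>M M) borel (case_prod T)"
    using bind_distr_eq_distr_pair[OF sf(2), where \<nu>=\<nu> and T=T and N=borel]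
    by (simp add: space T_def transition_def[abs_def] split_beta')
  have int: "has_bochner_integral (\<nu> \<bind> transition M F \<eta> k) f r"
    if "f \<in> borel_measurable borel" "has_bochner_integral (\<nu> \<Otimes>\<^sub>M M) (\<lambda>p. f (F *v fst p + \<eta> k (snd p))) r"
    for f :: "real^'n \<Rightarrow> real" and r
    unfolding bind using that by (subst has_bochner_integral_distr_iff) (auto simp: T_def split_beta')
  note pair = has_bochner_integral_pair_mult[OF sf]
  \<comment> \<open>Moving \<open>F\<close> to the test direction reduces the claim to moments of
    the input law in the direction \<open>a v* F\<close>.\<close>
  have split: "a \<bullet> (F *v \<xi> + u - F *v m) = (a v* F) \<bullet> (\<xi> - m) + a \<bullet> u" for a \<xi> u
    by (simp add: dot_lmul_matrix matrix_vector_mult_diff_distrib inner_diff_right inner_add_right)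
  show ?thesis
  proof (rule has_mean_covI)
    show "sets (\<nu> \<bind> transition M F \<eta> k) = sets borel" by (simp add: bind)
    show "has_bochner_integral (\<nu> \<bind> transition M F \<eta> k) (\<lambda>_. 1) z"
    proof (rule int)
      have "has_bochner_integral (\<nu> \<Otimes>\<^sub>M M) (\<lambda>_. 1 * 1) (z * 1)"
        by (rule pair[OF one\<nu> oneM])
      then show "has_bochner_integral (\<nu> \<Otimes>\<^sub>M M) (\<lambda>_. 1) z"
        by (simp only: mult_1_right)
    qed (rule measurable_const, simp)
    show "0 < z" using pos by (simp add: z_def)
    show "has_bochner_integral (\<nu> \<bind> transition M F \<eta> k) (\<lambda>x. a \<bullet> (x - F *v m)) 0" for a
    proof (rule int)
      show "has_bochner_integral (\<nu> \<Otimes>\<^sub>M M) (\<lambda>p. a \<bullet> (F *v fst p + \<eta> k (snd p) - F *v m)) 0"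
        unfolding split
        using has_bochner_integral_add[OF pair[OF has_mean_covD(1)[OF \<nu>, of "a v* F"] oneM] pair[OF one\<nu> mean[of a]]]
        by simp
    qed measurable
    show "has_bochner_integral (\<nu> \<bind> transition M F \<eta> k) (\<lambda>x. (a \<bullet> (x - F *v m))\<^sup>2)
        (z * (a \<bullet> ((F ** C ** transpose F + D) *v a)))" for a
    proof (rule int)
      let ?b = "a v* F"
      have "has_bochner_integral (\<nu> \<Otimes>\<^sub>M M)
        (\<lambda>p. (?b \<bullet> (fst p - m))\<^sup>2 * 1 + 1 * (a \<bullet> \<eta> k (snd p))\<^sup>2 + 2 * ((?b \<bullet> (fst p - m)) * (a \<bullet> \<eta> k (snd p))))
        (z * (?b \<bullet> (C *v ?b)) * 1 + z * (a \<bullet> (D *v a)) + 2 * (0 * 0))"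
        using has_mean_covD[OF \<nu>] by (intro has_bochner_integral_add has_bochner_integral_mult_right
            pair mean cov one\<nu> oneM) (auto simp: z_def)
      moreover have "?b \<bullet> (C *v ?b) = a \<bullet> ((F ** C ** transpose F) *v a)"
        by (simp add: dot_lmul_matrix matrix_vector_mul_assoc[symmetric])
      ultimately show "has_bochner_integral (\<nu> \<Otimes>\<^sub>M M) (\<lambda>p. (a \<bullet> (F *v fst p + \<eta> k (snd p) - F *v m))\<^sup>2)
        (z * (a \<bullet> ((F ** C ** transpose F + D) *v a)))"
        unfolding split by (simp add: power2_sum matrix_vector_mult_add_rdistrib inner_add_right distrib_left mult.assoc)
    qed measurable
    show "transpose (F ** C ** transpose F + D) = F ** C ** transpose F + D"
      using has_mean_covD(3)[OF \<nu>] D by (simp add: transpose_add matrix_transpose_mul matrix_mul_assoc)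
  qed
qed

section \<open>The risk-sensitive estimate\<close>

lemma unnormalized_gaussian_finite:
  assumes "unnormalized_gaussian \<nu> m P"
  shows "sets \<nu> = sets borel" "emeasure \<nu> UNIV \<noteq> 0" "emeasure \<nu> UNIV \<noteq> \<infinity>"
  using unnormalized_gaussian_has_mean_cov[OF assms]
  by (auto simp: has_mean_cov_def finite_measure.emeasure_eq_measure)

text \<open>
  The cost is invariant under reflection in the mean, so the parallelogram law bounds the cost at
  \<open>\<zeta>\<close> from below by a multiple \<open>exp (\<mu> |\<zeta> - m|\<^sup>2)\<close> of the cost at the mean.
\<close>

lemma risk_sensitive_minimizer_eq_mean:
  fixes \<nu> :: "(real^'n) measure"
  assumes \<nu>: "unnormalized_gaussian \<nu> m P" and \<mu>: "0 < \<mu>"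
  defines "J \<equiv> \<lambda>\<zeta>. \<integral>\<^sup>+ x. ennreal (exp (\<mu> * ((x - \<zeta>) \<bullet> (x - \<zeta>)))) \<partial>\<nu>"
  assumes fin: "J \<zeta> < \<infinity>" and min: "\<And>\<zeta>'. J \<zeta> \<le> J \<zeta>'"
  shows "\<zeta> = m"
proof -
  define d where "d = \<zeta> - m"
  define X where "X = matrix_inv P"
  obtain c where c: "0 < c"
    and eq: "\<nu> = density lborel (\<lambda>x. ennreal (c * exp (- (((x - m) \<bullet> (X *v (x - m))) / 2))))"
    using \<nu> unfolding unnormalized_gaussian_iff X_def by blast
  note [measurable_cong] = unnormalized_gaussian_finite(1)[OF \<nu>]
  have J: "J \<xi> = (\<integral>\<^sup>+ x. ennreal (c * exp (- (((x - m) \<bullet> (X *v (x - m))) / 2)))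
      * ennreal (exp (\<mu> * ((x - \<xi>) \<bullet> (x - \<xi>)))) \<partial>lborel)" for \<xi>
    unfolding J_def eq by (rule nn_integral_density) measurable
  have "J \<xi> = (\<integral>\<^sup>+ x. ennreal (c * exp (- (((x - m) \<bullet> (X *v (x - m))) / 2)))
      * ennreal (exp (\<mu> * ((x - \<xi>) \<bullet> (x - \<xi>)))) \<partial>distr lborel borel (\<lambda>x. 2 *\<^sub>R m - x))" for \<xi>
    unfolding lborel_distr_reflection by (rule J)
  also have "\<dots> \<xi> = J (2 *\<^sub>R m - \<xi>)" for \<xi>
  proof -
    have neg: "2 *\<^sub>R m - x - m = - (x - m)" "2 *\<^sub>R m - x - \<xi> = - (x - (2 *\<^sub>R m - \<xi>))" for x
      by (simp_all add: scaleR_2)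
    show ?thesis
      unfolding J by (subst nn_integral_distr)
        (simp_all only: neg linear_neg[OF matrix_vector_mul_linear] inner_minus_left inner_minus_right minus_minus, measurable)
  qed
  finally have refl: "J (m - d) = J \<zeta>"
    by (simp add: d_def scaleR_2 algebra_simps)
  define e where "e = exp (\<mu> * (d \<bullet> d))"
  have "2 * ennreal e * J m = (\<integral>\<^sup>+ x. ennreal (2 * e * exp (\<mu> * ((x - m) \<bullet> (x - m)))) \<partial>\<nu>)"
    unfolding J_def by (subst nn_integral_cmult[symmetric]) (auto simp: ennreal_mult e_def)
  also have "\<dots> \<le> (\<integral>\<^sup>+ x. ennreal (exp (\<mu> * ((x - \<zeta>) \<bullet> (x - \<zeta>)))) +
      ennreal (exp (\<mu> * ((x - (m - d)) \<bullet> (x - (m - d))))) \<partial>\<nu>)"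
  proof (intro nn_integral_mono)
    fix x
    define a where "a = \<mu> * ((x - \<zeta>) \<bullet> (x - \<zeta>))"
    define b where "b = \<mu> * ((x - (m - d)) \<bullet> (x - (m - d)))"
    have "(\<mu> * (d \<bullet> d)) + \<mu> * ((x - m) \<bullet> (x - m)) = (a + b) / 2"
    proof -
      have "(u - d) \<bullet> (u - d) + (u + d) \<bullet> (u + d) = 2 * (d \<bullet> d) + 2 * (u \<bullet> u)" for u
        by (simp add: inner_diff_left inner_diff_right inner_add_left inner_add_right)
      note parallelogram = this[of "x - m"]
      have "(x - m) - d = x - \<zeta>" "(x - m) + d = x - (m - d)" by (simp_all add: d_def)
      with parallelogram have "(a + b) = \<mu> * (2 * (d \<bullet> d) + 2 * ((x - m) \<bullet> (x - m)))"
        by (simp only: a_def b_def flip: distrib_left)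
      then show ?thesis by (simp add: distrib_left)
    qed
    then have "2 * e * exp (\<mu> * ((x - m) \<bullet> (x - m))) = 2 * (exp (a / 2) * exp (b / 2))"
      by (simp add: e_def exp_add[symmetric] add_divide_distrib mult.assoc)
    \<comment> \<open>Arithmetic-geometric mean inequality; \<open>a\<close> and \<open>b\<close>
      are the exponents at the candidate and at its mirror image.\<close>
    also have "\<dots> \<le> (exp (a / 2))\<^sup>2 + (exp (b / 2))\<^sup>2"
      using zero_le_power2[of "exp (a / 2) - exp (b / 2)"] by (simp add: power2_diff)
    also have "\<dots> = exp a + exp b"
      by (simp add: exp_double[symmetric])
    finally show "ennreal (2 * e * exp (\<mu> * ((x - m) \<bullet> (x - m)))) \<le> ennreal (exp (\<mu> * ((x - \<zeta>) \<bullet> (x - \<zeta>)))) +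
      ennreal (exp (\<mu> * ((x - (m - d)) \<bullet> (x - (m - d)))))"
      unfolding a_def b_def by (simp add: ennreal_plus[symmetric] del: ennreal_plus)
  qed
  also have "\<dots> = 2 * J \<zeta>"
    by (subst nn_integral_add) (use refl in \<open>simp_all add: J_def mult_2\<close>)
  finally have le: "2 * ennreal e * J m \<le> 2 * J \<zeta>" .
  \<comment> \<open>The integrand is at least 1, so the cost dominates the positive total mass.
    Being also finite, it can be cancelled in \<open>ennreal\<close>.\<close>
  have "emeasure \<nu> UNIV = (\<integral>\<^sup>+ x. 1 \<partial>\<nu>)"
    using sets_eq_imp_space_eq[OF unnormalized_gaussian_finite(1)[OF \<nu>]] by simp
  also have "\<dots> \<le> J \<zeta>"
    unfolding J_def using \<mu> by (intro nn_integral_mono) (simp add: ennreal_ge_1)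
  finally have "J \<zeta> \<noteq> 0"
    using unnormalized_gaussian_finite(2)[OF \<nu>] by auto
  with fin obtain r where r: "J \<zeta> = ennreal r" "0 < r"
    by (cases "J \<zeta>" rule: ennreal_cases) (auto simp: less_le)
  \<comment> \<open>Minimality at the mean gives
    \<open>e * J \<zeta> \<le> e * J m \<le> J \<zeta>\<close>; cancelling leaves
    \<open>e \<le> 1\<close>, which forces \<open>d = 0\<close>.\<close>
  have "2 * ennreal e * ennreal r \<le> 2 * ennreal e * J m"
    using min[of m] r by (intro mult_left_mono) auto
  with le have "ennreal (2 * e * r) \<le> ennreal (2 * r)"
    using r by (simp add: ennreal_mult e_def)
  then have "e \<le> 1" using r by (simp add: ennreal_le_iff)
  then have "d \<bullet> d = 0" using \<mu> inner_ge_zero[of d] by (simp add: e_def mult_le_0_iff)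
  then show ?thesis by (simp add: d_def)
qed

section \<open>Evidence, and reduction of the path cost to the information state\<close>

lemma emeasure_information_state_Suc:
  fixes p0 :: "(real^'n) measure"
  assumes L: "L (Suc k) \<in> borel_measurable borel"
    and K: "K k \<in> borel \<rightarrow>\<^sub>M subprob_algebra borel"
    and sets: "sets (information_state p0 K L \<mu>1 xh k) = sets borel"
  shows "emeasure (information_state p0 K L \<mu>1 xh (Suc k)) UNIV =
    (\<integral>\<^sup>+ x. ennreal (L (Suc k) x) \<partial>predict K \<mu>1 xh k (information_state p0 K L \<mu>1 xh k))
      * inverse (evidence p0 K L (Suc k) / evidence p0 K L k)"
proof -
  let ?p = "predict K \<mu>1 xh k (information_state p0 K L \<mu>1 xh k)"
  have sK: "sets (K k x) = sets borel" for x
    by (rule subprob_measurableD(2)[OF K]) simp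
  have sp[measurable_cong]: "sets ?p = sets borel"
    using sets_eq_imp_space_eq[OF sets] unfolding predict_def by (subst sets_bind[where N=borel]) (auto simp: sK)
  note [measurable] = L
  have "space ?p = UNIV" using sets_eq_imp_space_eq[OF sp] by simp
  then show ?thesis
    using sets.top[of ?p] by (simp add: emeasure_density divide_ennreal_def nn_integral_multc)
qed

text \<open>
  A vanishing or infinite evidence would force the total mass of the information state to be \<open>0\<close>
  or \<open>\<infinity>\<close>, by the conventions for division in \<open>ennreal\<close>.
\<close>

lemma evidence_nondegenerate:
  fixes p0 :: "(real^'n) measure"
  assumes "prob_space p0"
    and L: "\<And>j. L j \<in> borel_measurable borel"
    and K: "\<And>j. K j \<in> borel \<rightarrow>\<^sub>M subprob_algebra borel"
    and gauss: "\<And>j. j \<le> k \<Longrightarrow> \<exists>m. unnormalized_gaussian (information_state p0 K L \<mu>1 xh j) m (P j)"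
  shows "evidence p0 K L 0 = 1" and "j \<le> k \<Longrightarrow> evidence p0 K L j \<noteq> 0 \<and> evidence p0 K L j \<noteq> \<infinity>"
proof -
  show e0: "evidence p0 K L 0 = 1"
    using prob_space.emeasure_space_1[OF assms(1)] by (simp add: evidence_def)
  show "evidence p0 K L j \<noteq> 0 \<and> evidence p0 K L j \<noteq> \<infinity>" if "j \<le> k"
    using that
  proof (induction j)
    case (Suc j)
    obtain m m' where g: "unnormalized_gaussian (information_state p0 K L \<mu>1 xh j) m (P j)"
      "unnormalized_gaussian (information_state p0 K L \<mu>1 xh (Suc j)) m' (P (Suc j))"
      using gauss[of j] gauss[of "Suc j"] Suc.prems by auto
    define r where "r = evidence p0 K L (Suc j) / evidence p0 K L j"
    obtain X where X: "emeasure (information_state p0 K L \<mu>1 xh (Suc j)) UNIV = X * inverse r"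
      using emeasure_information_state_Suc[where L=L and K=K, OF L K unnormalized_gaussian_finite(1)[OF g(1)]] by (metis r_def)
    have "X * inverse r \<noteq> 0" "X * inverse r \<noteq> \<infinity>"
      using unnormalized_gaussian_finite[OF g(2)] X by auto
    \<comment> \<open>For \<open>r = 0\<close> the product would be \<open>X * \<infinity>\<close>,
      that is 0 or infinite; for \<open>r = \<infinity>\<close> it would be 0.\<close>
    then have "r \<noteq> 0" "r \<noteq> \<infinity>"
      by (auto simp: ennreal_mult_eq_top_iff)
    moreover have "evidence p0 K L j \<noteq> 0" "evidence p0 K L j \<noteq> \<infinity>" using Suc by auto
    ultimately show ?case
      by (auto simp: r_def divide_ennreal_def ennreal_mult_eq_top_iff)
  qed (simp add: e0)
qed

text \<open>The exponential of the accumulated errors is already contained in the information state;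
  the remaining factor depends on the last state only and serves as the test function.\<close>

lemma risk_cost_eq_nn_integral_information_state:
  fixes K :: "nat \<Rightarrow> real^'n \<Rightarrow> (real^'n) measure"
  assumes p0: "prob_space p0" "sets p0 = sets borel"
    and L: "\<And>j. L j \<in> borel_measurable borel"
    and K: "\<And>j. K j \<in> borel \<rightarrow>\<^sub>M subprob_algebra borel"
    and gauss: "\<And>j. j \<le> k \<Longrightarrow> \<exists>m. unnormalized_gaussian (information_state p0 K L \<mu>1 xh j) m (P j)"
  shows "risk_cost p0 K L \<mu>1 \<mu>2 xh k \<zeta> =
    (\<integral>\<^sup>+ x. ennreal (exp (\<mu>2 k * ((x - \<zeta>) \<bullet> (x - \<zeta>)))) \<partial>information_state p0 K L \<mu>1 xh k)"
proof -
  have ev: "evidence p0 K L 0 = 1"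
    "\<And>j. j \<le> k \<Longrightarrow> evidence p0 K L j \<noteq> 0" "\<And>j. j \<le> k \<Longrightarrow> evidence p0 K L j \<noteq> \<infinity>"
    using evidence_nondegenerate[where L=L and K=K, OF p0(1) L K gauss] by auto
  show ?thesis
    by (subst nn_integral_information_state[where L=L and K=K, OF p0(2) K L ev(2,3,1)])
      (auto simp: risk_cost_def exp_add ennreal_mult)
qed

section \<open>Moments of the shifted noise\<close>

text \<open>Bochner integrals of non-integrable functions are 0 by convention, so an equation for
  \<open>cross_moment\<close> does not by itself give integrability; the Gaussian law does.\<close>

lemma (in prob_space) gaussian_vector_square_integrable:
  assumes "gaussian_vector M X"
  shows "integrable M (\<lambda>\<omega>. (a \<bullet> X \<omega>)\<^sup>2)"
proof -
  have [measurable]: "X \<in> borel_measurable M" using assms by (simp add: gaussian_vector_def)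
  consider m where "AE \<omega> in M. a \<bullet> X \<omega> = m"
    | m s where "0 < s" "distributed M lborel (\<lambda>\<omega>. a \<bullet> X \<omega>) (\<lambda>t. ennreal (normal_density m s t))"
    using assms unfolding gaussian_vector_def by blast
  then show ?thesis
  proof cases
    case 1
    have "integrable M (\<lambda>\<omega>. m\<^sup>2)" by simp
    then show ?thesis by (rule integrable_cong_AE_imp) (use 1 in auto)
  next
    case 2
    \<comment> \<open>Expansion of \<open>t\<^sup>2\<close> in powers of \<open>t - m\<close>, to
      reach the centred normal moments.\<close>
    have "integrable lborel (\<lambda>t. normal_density m s t * (t - m) ^ 2 + 2 * m * (normal_density m s t * (t - m) ^ 1)
        + m\<^sup>2 * (normal_density m s t * (t - m) ^ 0))"
      by (intro Bochner_Integration.integrable_add integrable_mult_right integrable_normal_moment 2)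
    also have "(\<lambda>t. normal_density m s t * (t - m) ^ 2 + 2 * m * (normal_density m s t * (t - m) ^ 1)
        + m\<^sup>2 * (normal_density m s t * (t - m) ^ 0)) = (\<lambda>t. normal_density m s t * t\<^sup>2)"
      by (simp add: power2_eq_square algebra_simps)
    finally show ?thesis
      using distributed_integrable[OF 2(2), of "\<lambda>t. t\<^sup>2"] by simp
  qed
qed

lemma has_bochner_integral_cross_moment:
  fixes X :: "'a \<Rightarrow> real^'n" and Y :: "'a \<Rightarrow> real^'m"
  assumes [measurable]: "X \<in> borel_measurable M" "Y \<in> borel_measurable M"
    and "\<And>a. integrable M (\<lambda>\<omega>. (a \<bullet> X \<omega>)\<^sup>2)" "\<And>a. integrable M (\<lambda>\<omega>. (a \<bullet> Y \<omega>)\<^sup>2)"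
  shows "has_bochner_integral M (\<lambda>\<omega>. (a \<bullet> X \<omega>) * (b \<bullet> Y \<omega>)) (a \<bullet> (cross_moment M X Y *v b))"
proof -
  have "integrable M (\<lambda>\<omega>. (X \<omega> $ i)\<^sup>2)" "integrable M (\<lambda>\<omega>. (Y \<omega> $ j)\<^sup>2)" for i j
    using assms(3)[of "axis i 1"] assms(4)[of "axis j 1"] by (simp_all add: inner_axis')
  then have "has_bochner_integral M (\<lambda>\<omega>. X \<omega> $ i * Y \<omega> $ j) (cross_moment M X Y $ i $ j)" for i j
    using integrable_mult_if_square_integrable[of "\<lambda>\<omega>. X \<omega> $ i" M "\<lambda>\<omega>. Y \<omega> $ j"]
    by (simp add: has_bochner_integral_iff cross_moment_def)
  then have "has_bochner_integral M (\<lambda>\<omega>. \<Sum>i\<in>UNIV. \<Sum>j\<in>UNIV. a $ i * b $ j * (X \<omega> $ i * Y \<omega> $ j))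
      (\<Sum>i\<in>UNIV. \<Sum>j\<in>UNIV. a $ i * b $ j * (cross_moment M X Y $ i $ j))"
    by (intro has_bochner_integral_sum has_bochner_integral_mult_right)
  moreover have "(\<Sum>i\<in>UNIV. \<Sum>j\<in>UNIV. a $ i * b $ j * (u $ i * t $ j)) = (a \<bullet> u) * (b \<bullet> t)" for u t
    unfolding inner_vec_def sum_product by (intro sum.cong refl) simp
  moreover have "(\<Sum>i\<in>UNIV. \<Sum>j\<in>UNIV. a $ i * b $ j * (cross_moment M X Y $ i $ j)) = a \<bullet> (cross_moment M X Y *v b)"
    by (simp add: inner_vec_def matrix_vector_mult_def sum_distrib_left mult_ac)
  ultimately show ?thesis by simp
qed

lemma sum_matrix_vector_mult:
  "(\<Sum>i\<in>I. f i :: real^'n^'m) *v x = (\<Sum>i\<in>I. f i *v x)"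
  by (induction I rule: infinite_finite_induct) (simp_all add: matrix_vector_mult_add_rdistrib)

lemma inner_shifted_noise:
  "a \<bullet> shifted_noise Bc h w k \<omega> = (\<Sum>i\<le>h. (a v* Bc i) \<bullet> w (k + i) \<omega>)"
  by (simp add: shifted_noise_def inner_sum_right dot_lmul_matrix)

lemma borel_measurable_shifted_noise:
  assumes [measurable]: "\<And>j. w j \<in> borel_measurable M"
  shows "shifted_noise Bc h w k \<in> borel_measurable M"
  unfolding shifted_noise_def by measurable

lemma shifted_noise_mean:
  assumes "\<And>j. zero_mean M (w j)"
  shows "has_bochner_integral M (\<lambda>\<omega>. a \<bullet> shifted_noise Bc h w k \<omega>) 0"
proof -
  have "has_bochner_integral M (\<lambda>\<omega>. b \<bullet> w j \<omega>) 0" for b j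
    using assms[of j] by (simp add: zero_mean_def has_bochner_integral_iff)
  then have "has_bochner_integral M (\<lambda>\<omega>. \<Sum>i\<le>h. (a v* Bc i) \<bullet> w (k + i) \<omega>) (\<Sum>i\<le>h. 0)"
    by (intro has_bochner_integral_sum)
  then show ?thesis by (simp add: inner_shifted_noise)
qed

text \<open>The shifts \<open>k + i\<close> and \<open>k + j\<close> coincide only for
  \<open>i = j\<close>, so whiteness of the noise reduces the double sum to its diagonal.\<close>

lemma shifted_noise_second_moment:
  fixes w :: "nat \<Rightarrow> 'a \<Rightarrow> real^'r"
  assumes "\<And>j. w j \<in> borel_measurable M" and "\<And>j a. integrable M (\<lambda>\<omega>. (a \<bullet> w j \<omega>)\<^sup>2)"
    and Q: "\<And>j. cross_moment M (w j) (w j) = Q j"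
    and orth: "\<And>i j. i \<noteq> j \<Longrightarrow> cross_moment M (w i) (w j) = 0"
  shows "has_bochner_integral M (\<lambda>\<omega>. (a \<bullet> shifted_noise Bc h w k \<omega>)\<^sup>2) (a \<bullet> (shifted_noise_cov Bc h Q k *v a))"
proof -
  let ?b = "\<lambda>i. a v* Bc i"
  have cm: "cross_moment M (w (k + i)) (w (k + j)) = (if i = j then Q (k + i) else 0)" for i j
    using Q orth by auto
  have "has_bochner_integral M (\<lambda>\<omega>. \<Sum>i\<le>h. \<Sum>j\<le>h. (?b i \<bullet> w (k + i) \<omega>) * (?b j \<bullet> w (k + j) \<omega>))
    (\<Sum>i\<le>h. \<Sum>j\<le>h. ?b i \<bullet> (cross_moment M (w (k + i)) (w (k + j)) *v ?b j))"
    by (intro has_bochner_integral_sum has_bochner_integral_cross_moment assms)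
  moreover have "(\<Sum>j\<le>h. ?b i \<bullet> (cross_moment M (w (k + i)) (w (k + j)) *v ?b j)) = ?b i \<bullet> (Q (k + i) *v ?b i)"
    if "i \<le> h" for i
  proof -
    have "?b i \<bullet> (cross_moment M (w (k + i)) (w (k + j)) *v ?b j) = (if i = j then ?b i \<bullet> (Q (k + i) *v ?b i) else 0)" for j
      by (simp add: cm)
    then show ?thesis using that by simp
  qed
  moreover have "a \<bullet> (shifted_noise_cov Bc h Q k *v a) = (\<Sum>i\<le>h. ?b i \<bullet> (Q (k + i) *v ?b i))"
    by (simp add: shifted_noise_cov_def sum_matrix_vector_mult inner_sum_right dot_lmul_matrix
        matrix_vector_mul_assoc[symmetric])
  ultimately show ?thesis
    by (simp add: inner_shifted_noise power2_eq_square sum_product)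
qed

lemma transpose_sum: "transpose (\<Sum>i\<in>I. f i :: real^'n^'m) = (\<Sum>i\<in>I. transpose (f i))"
  by (simp add: transpose_def vec_eq_iff)

lemma transpose_shifted_noise_cov:
  assumes "\<And>j. transpose (Q j) = Q j"
  shows "transpose (shifted_noise_cov Bc h Q k) = shifted_noise_cov Bc h Q k"
  by (simp add: shifted_noise_cov_def transpose_sum matrix_transpose_mul assms matrix_mul_assoc)

text \<open>State \<open>k\<close> arises from state \<open>k - 1\<close> and the disturbance at
  \<open>k - 1\<close>, so the noise covariance carries the index \<open>k - 1\<close>, where the
  informal formula writes \<open>k\<close>. The outcome \<open>\<omega>\<close> fixes the
  measurement record entering \<open>L\<close>.\<close>

theorem theorem1:
  fixes E A U V A1 N \<Sigma>0 :: "real^'n^'n" and B :: "real^'r^'n" and H :: "real^'n^'q"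
    and S :: "'n set" and h k :: nat
    and M :: "'a measure" and \<omega> :: 'a
    and x :: "nat \<Rightarrow> 'a \<Rightarrow> real^'n" and y :: "nat \<Rightarrow> 'a \<Rightarrow> real^'q"
    and w :: "nat \<Rightarrow> 'a \<Rightarrow> real^'r" and v :: "nat \<Rightarrow> 'a \<Rightarrow> real^'q"
    and Q :: "nat \<Rightarrow> real^'r^'r" and R :: "nat \<Rightarrow> real^'q^'q"
    and cq :: "'q \<Rightarrow> nat" and cs :: "'s::finite \<Rightarrow> nat" and sel :: "nat \<Rightarrow> 's \<Rightarrow> 'q"
    and \<mu>1 \<mu>2 :: "nat \<Rightarrow> real"
    and xhat :: "nat \<Rightarrow> real^'n" and P :: "nat \<Rightarrow> real^'n^'n"
    and \<sigma> :: nat and Abar :: "real^'n^'n" and Bcoeff :: "nat \<Rightarrow> real^'r^'n" and Hbar :: "nat \<Rightarrow> real^'n^'s"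
    and xbar :: "nat \<Rightarrow> 'a \<Rightarrow> real^'n" and p0 :: "(real^'n) measure"
    and K :: "nat \<Rightarrow> real^'n \<Rightarrow> (real^'n) measure" and L :: "nat \<Rightarrow> real^'n \<Rightarrow> real"
  defines "\<sigma> \<equiv> rr_period CARD('q) CARD('s)"
    and "Abar \<equiv> block_diag S A1 0"
    and "Bcoeff \<equiv> noise_coeff S N (U ** B)"
    and "Hbar \<equiv> (\<lambda>m. select (sel m) (H ** V))"
    and "xbar \<equiv> (\<lambda>j \<omega>. matrix_inv V *v x j \<omega>)"
    and "p0 \<equiv> distr M borel (xbar 0)"
    and "K \<equiv> transition M Abar (shifted_noise Bcoeff h w)"
    and "L \<equiv> (\<lambda>j z. let m = rr_round \<sigma> j in
                 gauss_density (Hbar m *v z) (select_cov (sel m) (R j)) (select (sel m) (y j \<omega>)))"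
  assumes "prob_space M"
    and "rank E < CARD('n)" and "regular_pencil E A"
    and "weierstrass_form E A U V S A1 N h"
    and "\<And>j. x j \<in> borel_measurable M"
    and "\<And>j \<omega>. \<omega> \<in> space M \<Longrightarrow> E *v x (Suc j) \<omega> = A *v x j \<omega> + B *v w j \<omega>"
    and "\<And>j \<omega>. \<omega> \<in> space M \<Longrightarrow> y j \<omega> = H *v x j \<omega> + v j \<omega>"
    and "\<And>j. gaussian_vector M (w j)" and "\<And>j. zero_mean M (w j)"
    and "\<And>j. cross_moment M (w j) (w j) = Q j"
    and "\<And>i j. i \<noteq> j \<Longrightarrow> cross_moment M (w i) (w j) = 0"
    and "\<And>j. gaussian_vector M (v j)" and "\<And>j. zero_mean M (v j)"
    and "\<And>j. cross_moment M (v j) (v j) = R j"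
    and "\<And>i j. cross_moment M (w i) (v j) = 0"
    and "zero_mean M (x 0)" and "cross_moment M (x 0) (x 0) = \<Sigma>0"
    and "\<And>j. independent M (x 0) (v j)"
    and "\<exists>l. \<forall>j\<ge>l. cross_moment M (x 0) (w j) = 0"
    and "CARD('s) \<le> CARD('q)" and "round_robin cq cs sel"
    and "\<And>i. 0 \<le> \<mu>1 i" and "\<And>i. 0 < \<mu>2 i"
    and "1 \<le> k" and "\<omega> \<in> space M"
    and "\<And>j. j < k \<Longrightarrow> risk_sensitive_estimate p0 K L \<mu>1 \<mu>2 xhat j"
    and "\<And>j. j < k \<Longrightarrow> \<exists>m. unnormalized_gaussian (information_state p0 K L \<mu>1 xhat j) m (P j)"
    and "\<And>j. j < k \<Longrightarrow> pos_def (mat 1 - (2 * \<mu>1 j) *\<^sub>R P j)"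
  shows "has_mean_cov (predicted_information_state p0 K L \<mu>1 xhat k)
           (Abar *v xhat (k - 1))
           (Abar ** matrix_inv (matrix_inv (P (k - 1)) - (2 * \<mu>1 (k - 1)) *\<^sub>R mat 1) ** transpose Abar
             + shifted_noise_cov Bcoeff h Q (k - 1))"
proof -
  interpret prob_space M by fact
  have w [measurable]: "w j \<in> borel_measurable M" for j
    using \<open>\<And>j. gaussian_vector M (w j)\<close>[of j] by (simp add: gaussian_vector_def)
  note [measurable] = \<open>\<And>j. x j \<in> borel_measurable M\<close>
  have K: "K j \<in> borel \<rightarrow>\<^sub>M subprob_algebra borel" for j
    unfolding K_def by (intro measurable_transition borel_measurable_shifted_noise w)
  have L: "L j \<in> borel_measurable borel" for j
    unfolding L_def Let_def gauss_density_def by measurable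
  have p0: "prob_space p0" "sets p0 = sets borel"
    unfolding p0_def xbar_def by (auto intro: prob_space_distr)
  \<comment> \<open>For \<open>k = 1\<close> this is time 0, where the information state is the
    initial law.\<close>
  define j where "j = k - 1"
  have j: "j < k" using \<open>1 \<le> k\<close> by (simp add: j_def)
  let ?\<Phi> = "information_state p0 K L \<mu>1 xhat j"
  have gauss: "\<exists>m. unnormalized_gaussian (information_state p0 K L \<mu>1 xhat i) m (P i)" if "i \<le> j" for i
    using assms(35) that j by auto
  obtain m where m: "unnormalized_gaussian ?\<Phi> m (P j)" using gauss[of j] by auto
  have cost: "risk_cost p0 K L \<mu>1 \<mu>2 xhat j \<zeta> =
      (\<integral>\<^sup>+ z. ennreal (exp (\<mu>2 j * ((z - \<zeta>) \<bullet> (z - \<zeta>)))) \<partial>?\<Phi>)" for \<zeta>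
    by (rule risk_cost_eq_nn_integral_information_state[where L=L and K=K, OF p0 L K gauss])
  \<comment> \<open>The Gaussian assumption supplies the mean only existentially; minimality of the
    estimate identifies it.\<close>
  have "xhat j = m"
    using assms(34)[OF j] \<open>\<And>i. 0 < \<mu>2 i\<close>[of j] unfolding risk_sensitive_estimate_def cost
    by (intro risk_sensitive_minimizer_eq_mean[OF m]) auto
  with m have "unnormalized_gaussian (density ?\<Phi> (\<lambda>\<xi>. ennreal (exp (\<mu>1 j * ((\<xi> - xhat j) \<bullet> (\<xi> - xhat j)))))) (xhat j)
      (matrix_inv (matrix_inv (P j) - (2 * \<mu>1 j) *\<^sub>R mat 1))"
    using assms(36)[OF j] \<open>\<And>i. 0 \<le> \<mu>1 i\<close>[of j] by (intro unnormalized_gaussian_tilt) auto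
  note tilted = unnormalized_gaussian_has_mean_cov[OF this]
  have Q: "transpose (Q i) = Q i" for i
    using \<open>\<And>j. cross_moment M (w j) (w j) = Q j\<close>[of i, symmetric]
    by (simp add: transpose_def cross_moment_def vec_eq_iff mult.commute)
  show ?thesis
    unfolding predicted_information_state_def predict_def j_def[symmetric] K_def
  proof (rule has_mean_cov_bind_transition)
    show "has_mean_cov (density (information_state p0 (transition M Abar (shifted_noise Bcoeff h w)) L \<mu>1 xhat j)
        (\<lambda>\<xi>. ennreal (exp (\<mu>1 j * ((\<xi> - xhat j) \<bullet> (\<xi> - xhat j)))))) (xhat j)
        (matrix_inv (matrix_inv (P j) - (2 * \<mu>1 j) *\<^sub>R mat 1))"
      using tilted by (simp add: K_def)
    show "shifted_noise Bcoeff h w j \<in> borel_measurable M"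
      by (rule borel_measurable_shifted_noise) (rule w)
    show "has_bochner_integral M (\<lambda>\<omega>. a \<bullet> shifted_noise Bcoeff h w j \<omega>) 0" for a
      by (rule shifted_noise_mean) fact
    show "has_bochner_integral M (\<lambda>\<omega>. (a \<bullet> shifted_noise Bcoeff h w j \<omega>)\<^sup>2)
        (a \<bullet> (shifted_noise_cov Bcoeff h Q j *v a))" for a
      by (rule shifted_noise_second_moment[OF w gaussian_vector_square_integrable]) fact+
    show "transpose (shifted_noise_cov Bcoeff h Q j) = shifted_noise_cov Bcoeff h Q j"
      by (rule transpose_shifted_noise_cov) (rule Q)
  qed
qed

end
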